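(* Assume $\neg\mathsf{SH}$, i.e. that there exists a Suslin line. Then there exists a unital commutative C*-algebra $\mathcal{A}$ which has CCC such that $\mathcal{A}\otimes\mathcal{A}$ does not have CCC.
   Context: Ideals of C*-algebras are closed two-sided ideals. Two nonzero ideals in a C*-algebra are orthogonal if their intersection is the zero ideal. A C*-algebra has the countable chain condition (CCC) if any family of nonzero mutually orthogonal ideals is countable (i.e. at most countable). $\otimes$ denotes the (minimal) C*-tensor product; for commutative C*-algebras there is only one C*-tensor product. A topological space has CCC if every family of mutually disjoint nonempty open subsets is countable. Let $S$ be a totally ordered set which is unbounded (no minimum or maximum element), dense (there is an element strictly between any two distinct elements) and complete (every nonempty bounded subset has a supremum and an infimum). Then $S$ is called a Suslin line if, with the order topology generated by open intervals, it is nonseparable but has CCC. Suslin's Hypothesis $\mathsf{SH}$ is the statement that there does not exist a Suslin line. *)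

theory Defs
  imports "HOL-Analysis.Analysis" "HOL-Algebra.Module" "HOL-Library.Poly_Mapping"
begin

section \<open>C*-algebras\<close>

definition complex_field :: "complex ring"
  where "complex_field = \<lparr>carrier = UNIV, mult = (*), one = 1, zero = 0, add = (+)\<rparr>"

record 'a star_alg = "(complex, 'a) module" +
  star :: "'a \<Rightarrow> 'a"

record 'a cstar_alg = "'a star_alg" +
  cnorm :: "'a \<Rightarrow> real"

text \<open>
  A unit is not required: \<^locale>\<open>module\<close> only makes \<open>A\<close> an abelian group, and the field
  \<^const>\<open>one\<close> is unconstrained. A C*-algebra \<open>A\<close> is unital with unit \<open>\<one>\<close> iff \<open>ring A\<close> holds, and
  unital and commutative iff \<open>cring A\<close> holds.
\<close>

locale star_algebra = module complex_field A for A :: "('a, 'm) star_alg_scheme" (structure) +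
  assumes mult_closed: "\<lbrakk>x \<in> carrier A; y \<in> carrier A\<rbrakk> \<Longrightarrow> x \<otimes> y \<in> carrier A"
    and mult_assoc: "\<lbrakk>x \<in> carrier A; y \<in> carrier A; z \<in> carrier A\<rbrakk>
      \<Longrightarrow> (x \<otimes> y) \<otimes> z = x \<otimes> (y \<otimes> z)"
    and distrib_left: "\<lbrakk>x \<in> carrier A; y \<in> carrier A; z \<in> carrier A\<rbrakk>
      \<Longrightarrow> x \<otimes> (y \<oplus> z) = x \<otimes> y \<oplus> x \<otimes> z"
    and distrib_right: "\<lbrakk>x \<in> carrier A; y \<in> carrier A; z \<in> carrier A\<rbrakk>
      \<Longrightarrow> (x \<oplus> y) \<otimes> z = x \<otimes> z \<oplus> y \<otimes> z"
    and smult_mult_left: "\<lbrakk>x \<in> carrier A; y \<in> carrier A\<rbrakk> \<Longrightarrow> (c \<odot> x) \<otimes> y = c \<odot> (x \<otimes> y)"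
    and smult_mult_right: "\<lbrakk>x \<in> carrier A; y \<in> carrier A\<rbrakk> \<Longrightarrow> x \<otimes> (c \<odot> y) = c \<odot> (x \<otimes> y)"
    and star_closed: "x \<in> carrier A \<Longrightarrow> star A x \<in> carrier A"
    and star_star: "x \<in> carrier A \<Longrightarrow> star A (star A x) = x"
    and star_add: "\<lbrakk>x \<in> carrier A; y \<in> carrier A\<rbrakk> \<Longrightarrow> star A (x \<oplus> y) = star A x \<oplus> star A y"
    and star_smult: "x \<in> carrier A \<Longrightarrow> star A (c \<odot> x) = cnj c \<odot> star A x"
    and star_mult: "\<lbrakk>x \<in> carrier A; y \<in> carrier A\<rbrakk> \<Longrightarrow> star A (x \<otimes> y) = star A y \<otimes> star A x"

locale cstar_norm = star_algebra A for A :: "('a, 'm) star_alg_scheme" (structure) +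
  fixes \<nu> :: "'a \<Rightarrow> real"
  assumes norm_nonneg: "x \<in> carrier A \<Longrightarrow> 0 \<le> \<nu> x"
    and norm_eq_zero: "x \<in> carrier A \<Longrightarrow> \<nu> x = 0 \<longleftrightarrow> x = \<zero>"
    and norm_triangle: "\<lbrakk>x \<in> carrier A; y \<in> carrier A\<rbrakk> \<Longrightarrow> \<nu> (x \<oplus> y) \<le> \<nu> x + \<nu> y"
    and norm_smult: "x \<in> carrier A \<Longrightarrow> \<nu> (c \<odot> x) = cmod c * \<nu> x"
    and norm_mult: "\<lbrakk>x \<in> carrier A; y \<in> carrier A\<rbrakk> \<Longrightarrow> \<nu> (x \<otimes> y) \<le> \<nu> x * \<nu> y"
    and norm_star_mult: "x \<in> carrier A \<Longrightarrow> \<nu> (star A x \<otimes> x) = (\<nu> x)\<^sup>2"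

text \<open>The value off the carrier is fixed only because \<^locale>\<open>Metric_space\<close> asks for a
  nonnegative symmetric function on the whole type.\<close>

definition cdist :: "('a, 'm) cstar_alg_scheme \<Rightarrow> 'a \<Rightarrow> 'a \<Rightarrow> real"
  where "cdist A x y =
    (if x \<in> carrier A \<and> y \<in> carrier A then cnorm A (x \<ominus>\<^bsub>A\<^esub> y) else 0)"

definition norm_topology :: "('a, 'm) cstar_alg_scheme \<Rightarrow> 'a topology"
  where "norm_topology A = Metric_space.mtopology (carrier A) (cdist A)"

locale cstar_algebra = cstar_norm A "cnorm A" for A :: "('a, 'm) cstar_alg_scheme" (structure) +
  assumes complete: "Metric_space.mcomplete (carrier A) (cdist A)"

definition closed_ideal :: "('a, 'm) cstar_alg_scheme \<Rightarrow> 'a set \<Rightarrow> bool"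
  where "closed_ideal A I \<longleftrightarrow>
    submodule I complex_field A \<and>
    (\<forall>a\<in>carrier A. \<forall>x\<in>I. a \<otimes>\<^bsub>A\<^esub> x \<in> I \<and> x \<otimes>\<^bsub>A\<^esub> a \<in> I) \<and>
    closedin (norm_topology A) I"

definition cstar_CCC :: "('a, 'm) cstar_alg_scheme \<Rightarrow> bool"
  where "cstar_CCC A \<longleftrightarrow>
    (\<forall>\<I>. (\<forall>I\<in>\<I>. closed_ideal A I \<and> I \<noteq> {\<zero>\<^bsub>A\<^esub>}) \<and>
          pairwise (\<lambda>I J. I \<inter> J = {\<zero>\<^bsub>A\<^esub>}) \<I> \<longrightarrow> countable \<I>)"


section \<open>The minimal C*-tensor product\<close>

text \<open>
  The algebraic tensor product \<open>A \<odot> B\<close> is the free complex vector space on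
  \<open>carrier A \<times> carrier B\<close> modulo the subspace \<open>tensor_relations A B\<close>. The latter is generated
  as an additive group by all scalar multiples of the bilinearity relators, hence it is
  closed under scalar multiplication.
\<close>

definition formal_sums ::
    "('a, 'm) star_alg_scheme \<Rightarrow> ('b, 'n) star_alg_scheme \<Rightarrow> ('a \<times> 'b \<Rightarrow>\<^sub>0 complex) set"
  where "formal_sums A B = {u. Poly_Mapping.keys u \<subseteq> carrier A \<times> carrier B}"

inductive_set tensor_relations ::
    "('a, 'm) star_alg_scheme \<Rightarrow> ('b, 'n) star_alg_scheme \<Rightarrow> ('a \<times> 'b \<Rightarrow>\<^sub>0 complex) set"
  for A :: "('a, 'm) star_alg_scheme" and B :: "('b, 'n) star_alg_scheme"
  where
    zero: "0 \<in> tensor_relations A B"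
  | add: "\<lbrakk>u \<in> tensor_relations A B; v \<in> tensor_relations A B\<rbrakk> \<Longrightarrow> u + v \<in> tensor_relations A B"
  | add_left: "\<lbrakk>a \<in> carrier A; a' \<in> carrier A; b \<in> carrier B\<rbrakk> \<Longrightarrow>
      Poly_Mapping.single (a \<oplus>\<^bsub>A\<^esub> a', b) c - Poly_Mapping.single (a, b) c
        - Poly_Mapping.single (a', b) c \<in> tensor_relations A B"
  | add_right: "\<lbrakk>a \<in> carrier A; b \<in> carrier B; b' \<in> carrier B\<rbrakk> \<Longrightarrow>
      Poly_Mapping.single (a, b \<oplus>\<^bsub>B\<^esub> b') c - Poly_Mapping.single (a, b) c
        - Poly_Mapping.single (a, b') c \<in> tensor_relations A B"
  | smult_left: "\<lbrakk>a \<in> carrier A; b \<in> carrier B\<rbrakk> \<Longrightarrow>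
      Poly_Mapping.single (r \<odot>\<^bsub>A\<^esub> a, b) c - Poly_Mapping.single (a, b) (c * r)
        \<in> tensor_relations A B"
  | smult_right: "\<lbrakk>a \<in> carrier A; b \<in> carrier B\<rbrakk> \<Longrightarrow>
      Poly_Mapping.single (a, r \<odot>\<^bsub>B\<^esub> b) c - Poly_Mapping.single (a, b) (c * r)
        \<in> tensor_relations A B"

definition tensor_lift ::
    "('c, 'm) star_alg_scheme \<Rightarrow> ('a \<Rightarrow> 'b \<Rightarrow> 'c) \<Rightarrow> ('a \<times> 'b \<Rightarrow>\<^sub>0 complex) \<Rightarrow> 'c"
  where "tensor_lift C t u =
    finsum C (\<lambda>p. Poly_Mapping.lookup u p \<odot>\<^bsub>C\<^esub> t (fst p) (snd p)) (Poly_Mapping.keys u)"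

text \<open>
  \<open>C\<close> is a completion of \<open>A \<odot> B\<close> with respect to a C*-norm, where \<open>t a b\<close> is the elementary
  tensor of \<open>a\<close> and \<open>b\<close>. The assumption \<open>injective\<close> says that the linear map
  \<open>A \<odot> B \<rightarrow> C\<close> induced by \<open>t\<close> is injective, so that its image \<open>algebraic_part\<close> is a copy of the
  *-algebra \<open>A \<odot> B\<close>.
\<close>

locale cstar_tensor_product =
    A: cstar_algebra A + B: cstar_algebra B + C: cstar_algebra C
  for A :: "('a, 'm) cstar_alg_scheme" and B :: "('b, 'n) cstar_alg_scheme"
    and C :: "('c, 'k) cstar_alg_scheme" +
  fixes t :: "'a \<Rightarrow> 'b \<Rightarrow> 'c"
  assumes tensor_closed: "\<lbrakk>a \<in> carrier A; b \<in> carrier B\<rbrakk> \<Longrightarrow> t a b \<in> carrier C"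
    and tensor_add_left: "\<lbrakk>a \<in> carrier A; a' \<in> carrier A; b \<in> carrier B\<rbrakk>
      \<Longrightarrow> t (a \<oplus>\<^bsub>A\<^esub> a') b = t a b \<oplus>\<^bsub>C\<^esub> t a' b"
    and tensor_add_right: "\<lbrakk>a \<in> carrier A; b \<in> carrier B; b' \<in> carrier B\<rbrakk>
      \<Longrightarrow> t a (b \<oplus>\<^bsub>B\<^esub> b') = t a b \<oplus>\<^bsub>C\<^esub> t a b'"
    and tensor_smult_left: "\<lbrakk>a \<in> carrier A; b \<in> carrier B\<rbrakk>
      \<Longrightarrow> t (r \<odot>\<^bsub>A\<^esub> a) b = r \<odot>\<^bsub>C\<^esub> t a b"
    and tensor_smult_right: "\<lbrakk>a \<in> carrier A; b \<in> carrier B\<rbrakk>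
      \<Longrightarrow> t a (r \<odot>\<^bsub>B\<^esub> b) = r \<odot>\<^bsub>C\<^esub> t a b"
    and tensor_mult: "\<lbrakk>a \<in> carrier A; a' \<in> carrier A; b \<in> carrier B; b' \<in> carrier B\<rbrakk>
      \<Longrightarrow> t a b \<otimes>\<^bsub>C\<^esub> t a' b' = t (a \<otimes>\<^bsub>A\<^esub> a') (b \<otimes>\<^bsub>B\<^esub> b')"
    and tensor_star: "\<lbrakk>a \<in> carrier A; b \<in> carrier B\<rbrakk>
      \<Longrightarrow> star C (t a b) = t (star A a) (star B b)"
    and injective: "\<lbrakk>u \<in> formal_sums A B; tensor_lift C t u = \<zero>\<^bsub>C\<^esub>\<rbrakk>
      \<Longrightarrow> u \<in> tensor_relations A B"
    and dense: "norm_topology C closure_of (tensor_lift C t ` formal_sums A B) = carrier C"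
begin

definition algebraic_part :: "('c, 'k) cstar_alg_scheme"
  where "algebraic_part = C\<lparr>carrier := tensor_lift C t ` formal_sums A B\<rparr>"

end

text \<open>The minimal C*-tensor product: its norm is the least C*-norm on \<open>A \<odot> B\<close>.\<close>

locale min_cstar_tensor_product = cstar_tensor_product +
  assumes minimal: "\<lbrakk>cstar_norm algebraic_part \<nu>; x \<in> carrier algebraic_part\<rbrakk>
    \<Longrightarrow> cnorm C x \<le> \<nu> x"


section \<open>Suslin lines\<close>

definition open_interval :: "'s rel \<Rightarrow> 's \<Rightarrow> 's \<Rightarrow> 's set"
  where "open_interval r a b = {x. (a, x) \<in> r \<and> x \<noteq> a \<and> (x, b) \<in> r \<and> x \<noteq> b}"

text \<open>For an order without minimum and maximum the open intervals cover \<open>S\<close>, so that \<open>S\<close>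
  is the whole space.\<close>

definition order_topology :: "'s set \<Rightarrow> 's rel \<Rightarrow> 's topology"
  where "order_topology S r = topology_generated_by {open_interval r a b |a b. a \<in> S \<and> b \<in> S}"

definition topological_CCC :: "'s topology \<Rightarrow> bool"
  where "topological_CCC X \<longleftrightarrow>
    (\<forall>\<U>. (\<forall>U\<in>\<U>. openin X U \<and> U \<noteq> {}) \<and> pairwise disjnt \<U> \<longrightarrow> countable \<U>)"

definition unbounded_order :: "'s set \<Rightarrow> 's rel \<Rightarrow> bool"
  where "unbounded_order S r \<longleftrightarrow>
    \<not> (\<exists>m\<in>S. \<forall>x\<in>S. (m, x) \<in> r) \<and> \<not> (\<exists>m\<in>S. \<forall>x\<in>S. (x, m) \<in> r)"

definition dense_order :: "'s set \<Rightarrow> 's rel \<Rightarrow> bool"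
  where "dense_order S r \<longleftrightarrow>
    (\<forall>a\<in>S. \<forall>b\<in>S. (a, b) \<in> r \<and> a \<noteq> b \<longrightarrow> (\<exists>x\<in>S. x \<in> open_interval r a b))"

definition upper_bounds :: "'s set \<Rightarrow> 's rel \<Rightarrow> 's set \<Rightarrow> 's set"
  where "upper_bounds S r T = {u \<in> S. \<forall>x\<in>T. (x, u) \<in> r}"

definition lower_bounds :: "'s set \<Rightarrow> 's rel \<Rightarrow> 's set \<Rightarrow> 's set"
  where "lower_bounds S r T = {l \<in> S. \<forall>x\<in>T. (l, x) \<in> r}"

definition complete_order :: "'s set \<Rightarrow> 's rel \<Rightarrow> bool"
  where "complete_order S r \<longleftrightarrow>
    (\<forall>T. T \<subseteq> S \<and> T \<noteq> {} \<and> upper_bounds S r T \<noteq> {} \<and> lower_bounds S r T \<noteq> {} \<longrightarrow>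
      (\<exists>s\<in>upper_bounds S r T. \<forall>u\<in>upper_bounds S r T. (s, u) \<in> r) \<and>
      (\<exists>i\<in>lower_bounds S r T. \<forall>l\<in>lower_bounds S r T. (l, i) \<in> r))"

definition suslin_line :: "'s set \<Rightarrow> 's rel \<Rightarrow> bool"
  where "suslin_line S r \<longleftrightarrow>
    linear_order_on S r \<and> unbounded_order S r \<and> dense_order S r \<and> complete_order S r \<and>
    \<not> separable_space (order_topology S r) \<and> topological_CCC (order_topology S r)"

text \<open>HOL cannot quantify over types inside a formula, so Suslin's hypothesis is stated for
  the totally ordered sets whose elements are of a given, arbitrary type.\<close>

definition SH :: "'s itself \<Rightarrow> bool"
  where "SH _ \<longleftrightarrow> \<not> (\<exists>(S :: 's set) r. suslin_line S r)"

end

theory Submission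
  imports Defs
begin

text \<open>
  Let \<open>S\<close> be a Suslin line and \<open>X\<close> the set \<open>S\<close> with the lower limit topology, which is generated by the
  intervals \<open>[a, b)\<close>. The algebra \<open>A\<close> consists of the bounded continuous functions on \<open>X\<close>, and
  \<open>A \<otimes> A\<close> is realised as the uniform closure of the functions \<open>(x, y) \<mapsto> \<Sum> a\<^sub>i x * b\<^sub>i y\<close> on \<open>X \<times> X\<close>.

  Chain conditions pass between spaces and algebras. Orthogonal ideals of \<open>A\<close> yield disjoint open
  sets of \<open>X\<close> (\<open>cstar_CCC_Cb\<close>), and disjoint open sets of \<open>X \<times> X\<close> yield orthogonal ideals of \<open>A \<otimes> A\<close>
  (\<open>not_cstar_CCC_Cb_tensor\<close>). The space \<open>X\<close> inherits CCC from \<open>S\<close>, since intervals \<open>[a, b)\<close> contain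
  nonempty intervals \<open>(a, b)\<close>. Its square fails CCC: a countable family of disjoint boxes
  \<open>[a, b) \<times> [b, c)\<close> can always be enlarged, because the countably many middle points \<open>b\<close> are not dense
  in the nonseparable line (\<open>not_topological_CCC_square\<close>).

  What remains is that the closure really is the minimal tensor product
  (\<open>min_cstar_tensor_product_Cb\<close>). That no formal sum outside the bilinearity relations is mapped to
  zero is linear algebra (\<open>tensor_lift_injective\<close>). That the supremum norm is the least C*-norm on the
  algebraic tensor product (\<open>sup_norm_le_cstar_norm\<close>) is proved without Gelfand theory: every
  C*-norm is bounded on elementary tensors by the product of the supremum norms, since a real
  function of norm at most \<open>1\<close> is an average of two unitaries; hence it notices that a sum of elementary
  tensors is nearly constant near each point, and multiplication with a bump function bounds that
  constant by the norm. The bump functions come from complete regularity, which is immediate for the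
  lower limit topology because \<open>[a, b)\<close> is clopen; hence this topology rather than the order topology.
\<close>

section \<open>Uniform algebras of bounded functions\<close>

abbreviation sup_norm :: "('x \<Rightarrow> complex) \<Rightarrow> real"
  where "sup_norm f \<equiv> (SUP x. cmod (f x))"

lemma norm_le_sup_norm:
  assumes "bounded (range f)"
  shows "cmod (f x) \<le> sup_norm f"
proof (rule cSUP_upper)
  obtain B where "\<forall>y\<in>range f. norm y \<le> B"
    using assms unfolding bounded_iff ..
  then show "bdd_above (range (\<lambda>x. cmod (f x)))"
    by (intro bdd_aboveI[of _ B]) auto
qed simp

lemma sup_norm_le: "(\<And>x. cmod (f x) \<le> c) \<Longrightarrow> sup_norm f \<le> c"
  by (rule cSUP_least) auto

lemma sup_norm_nonneg:
  assumes "bounded (range f)"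
  shows "0 \<le> sup_norm f"
  using norm_le_sup_norm[OF assms, of undefined] norm_ge_zero order_trans by blast

text \<open>
  The parameter \<open>S\<close> is the set on which the unit equals \<open>1\<close>. Functions on a subset of the type are
  represented by their extension by zero. Then equality of functions is equality in HOL, and the
  supremum in the norm may range over the whole type, which is never empty.
\<close>

definition fun_alg :: "('x \<Rightarrow> complex) set \<Rightarrow> 'x set \<Rightarrow> ('x \<Rightarrow> complex) cstar_alg"
  where "fun_alg D S =
    \<lparr>carrier = D, mult = \<lambda>f g x. f x * g x, one = indicator S, zero = \<lambda>x. 0,
     add = \<lambda>f g x. f x + g x, smult = \<lambda>c f x. c * f x, star = \<lambda>f x. cnj (f x),
     cnorm = sup_norm\<rparr>"

lemma fun_alg_simps [simp]:
  "carrier (fun_alg D S) = D"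
  "mult (fun_alg D S) = (\<lambda>f g x. f x * g x)"
  "one (fun_alg D S) = indicator S"
  "zero (fun_alg D S) = (\<lambda>x. 0)"
  "add (fun_alg D S) = (\<lambda>f g x. f x + g x)"
  "smult (fun_alg D S) = (\<lambda>c f x. c * f x)"
  "star (fun_alg D S) = (\<lambda>f x. cnj (f x))"
  "cnorm (fun_alg D S) = sup_norm"
  "fun_alg D S\<lparr>carrier := T\<rparr> = fun_alg T S"
  by (simp_all add: fun_alg_def)

lemma cring_complex_field: "cring complex_field"
proof (rule cringI)
  have "\<exists>y. y + x = 0" for x :: complex
    by (rule exI[of _ "- x"]) simp
  then show "abelian_group complex_field"
    by (intro abelian_groupI) (simp_all add: complex_field_def add.assoc add.commute)
  show "comm_monoid complex_field"
    by (intro comm_monoidI) (simp_all add: complex_field_def)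
qed (simp add: complex_field_def distrib_right)

locale function_star_algebra =
  fixes D :: "('x \<Rightarrow> complex) set"
  assumes zero_mem: "(\<lambda>x. 0) \<in> D"
    and add_mem: "\<lbrakk>f \<in> D; g \<in> D\<rbrakk> \<Longrightarrow> (\<lambda>x. f x + g x) \<in> D"
    and mult_mem: "\<lbrakk>f \<in> D; g \<in> D\<rbrakk> \<Longrightarrow> (\<lambda>x. f x * g x) \<in> D"
    and smult_mem: "f \<in> D \<Longrightarrow> (\<lambda>x. c * f x) \<in> D"
    and cnj_mem: "f \<in> D \<Longrightarrow> (\<lambda>x. cnj (f x)) \<in> D"
    and bounded_mem: "f \<in> D \<Longrightarrow> bounded (range f)"
begin

lemma uminus_mem: "f \<in> D \<Longrightarrow> (\<lambda>x. - f x) \<in> D"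
  using smult_mem[of f "-1"] by simp

lemma diff_mem: "\<lbrakk>f \<in> D; g \<in> D\<rbrakk> \<Longrightarrow> (\<lambda>x. f x - g x) \<in> D"
  using add_mem[OF _ uminus_mem, of f g] by simp

lemma abelian_group_fun_alg: "abelian_group (fun_alg D S)"
proof (rule abelian_groupI)
  fix f assume "f \<in> carrier (fun_alg D S)"
  then show "\<exists>g\<in>carrier (fun_alg D S). g \<oplus>\<^bsub>fun_alg D S\<^esub> f = \<zero>\<^bsub>fun_alg D S\<^esub>"
    by (auto intro!: bexI[OF _ uminus_mem])
qed (auto simp: add_mem zero_mem algebra_simps)

lemma star_algebra_fun_alg: "star_algebra (fun_alg D S)"
proof -
  have "module complex_field (fun_alg D S)"
    by (rule moduleI[OF cring_complex_field abelian_group_fun_alg])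
      (auto simp: complex_field_def smult_mem algebra_simps)
  then show ?thesis
    by (intro star_algebra.intro star_algebra_axioms.intro)
      (auto simp: mult_mem cnj_mem algebra_simps)
qed

lemma cring_fun_alg:
  assumes "indicator S \<in> D" "\<And>f x. f \<in> D \<Longrightarrow> x \<notin> S \<Longrightarrow> f x = 0"
  shows "cring (fun_alg D S)"
proof (rule cringI)
  show "comm_monoid (fun_alg D S)"
    using assms by (intro comm_monoidI)
      (auto simp: mult_mem fun_eq_iff algebra_simps indicator_def)
qed (use abelian_group_fun_alg in \<open>auto simp: algebra_simps\<close>)

lemma cstar_norm_fun_alg: "cstar_norm (fun_alg D S) sup_norm"
proof (intro cstar_norm.intro star_algebra_fun_alg cstar_norm_axioms.intro; simp only: fun_alg_simps)
  fix f assume f: "f \<in> D"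
  note bf = bounded_mem[OF f]
  show "0 \<le> sup_norm f"
    by (rule sup_norm_nonneg[OF bf])
  show "(sup_norm f = 0) = (f = (\<lambda>x. 0))"
    using norm_le_sup_norm[OF bf] by (auto simp: fun_eq_iff)
  show "sup_norm (\<lambda>x. c * f x) = cmod c * sup_norm f" for c
  proof (rule antisym)
    show "sup_norm (\<lambda>x. c * f x) \<le> cmod c * sup_norm f"
      by (rule sup_norm_le) (auto simp: norm_mult intro!: mult_left_mono norm_le_sup_norm bf)
    show "cmod c * sup_norm f \<le> sup_norm (\<lambda>x. c * f x)"
    proof (cases "c = 0")
      case False
      have "sup_norm f \<le> sup_norm (\<lambda>x. c * f x) / cmod c"
      proof (rule sup_norm_le)
        fix x
        have "cmod c * cmod (f x) \<le> sup_norm (\<lambda>x. c * f x)"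
          using norm_le_sup_norm[OF bounded_mem[OF smult_mem[OF f, of c]], of x]
          by (simp add: norm_mult)
        then show "cmod (f x) \<le> sup_norm (\<lambda>x. c * f x) / cmod c"
          using False by (simp add: field_simps)
      qed
      then show ?thesis using False by (simp add: field_simps)
    qed simp
  qed
  show "sup_norm (\<lambda>x. cnj (f x) * f x) = (sup_norm f)\<^sup>2"
  proof (rule antisym)
    show "sup_norm (\<lambda>x. cnj (f x) * f x) \<le> (sup_norm f)\<^sup>2"
      by (rule sup_norm_le)
        (auto simp: norm_mult power2_eq_square intro!: mult_mono norm_le_sup_norm bf sup_norm_nonneg)
    let ?s = "sup_norm (\<lambda>x. cnj (f x) * f x)"
    have "(cmod (f x))\<^sup>2 \<le> ?s" for x
      using norm_le_sup_norm[OF bounded_mem[OF mult_mem[OF cnj_mem[OF f] f]], of x]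
      by (simp add: norm_mult power2_eq_square)
    then have "sup_norm f \<le> sqrt ?s"
      by (intro sup_norm_le real_le_rsqrt)
    then show "(sup_norm f)\<^sup>2 \<le> ?s"
      using sup_norm_nonneg[OF bf] sup_norm_nonneg[OF bounded_mem[OF mult_mem[OF cnj_mem[OF f] f]]]
      by (metis power_mono real_sqrt_pow2)
  qed
  fix g assume g: "g \<in> D"
  note bg = bounded_mem[OF g]
  show "sup_norm (\<lambda>x. f x + g x) \<le> sup_norm f + sup_norm g"
    by (rule sup_norm_le) (intro order_trans[OF norm_triangle_ineq] add_mono norm_le_sup_norm bf bg)
  show "sup_norm (\<lambda>x. f x * g x) \<le> sup_norm f * sup_norm g"
    by (rule sup_norm_le)
      (auto simp: norm_mult intro!: mult_mono norm_le_sup_norm bf bg sup_norm_nonneg)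
qed

lemma minus_fun_alg:
  assumes "f \<in> D" "g \<in> D"
  shows "f \<ominus>\<^bsub>fun_alg D S\<^esub> g = (\<lambda>x. f x - g x)"
proof -
  interpret abelian_group "fun_alg D S" by (rule abelian_group_fun_alg)
  have "\<ominus>\<^bsub>fun_alg D S\<^esub> g = (\<lambda>x. - g x)"
    by (rule minus_equality) (use assms in \<open>auto simp: uminus_mem\<close>)
  then show ?thesis by (simp add: a_minus_def)
qed

lemma cdist_fun_alg:
  "\<lbrakk>f \<in> D; g \<in> D\<rbrakk> \<Longrightarrow> cdist (fun_alg D S) f g = sup_norm (\<lambda>x. f x - g x)"
  by (simp add: cdist_def minus_fun_alg)

lemma Metric_space_fun_alg: "Metric_space D (cdist (fun_alg D S))"
proof
  fix f g h
  interpret N: cstar_norm "fun_alg D S" sup_norm by (rule cstar_norm_fun_alg)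
  show "0 \<le> cdist (fun_alg D S) f g"
    by (auto simp: cdist_def minus_fun_alg intro!: sup_norm_nonneg bounded_mem diff_mem)
  show "cdist (fun_alg D S) f g = cdist (fun_alg D S) g f"
    by (simp add: cdist_def minus_fun_alg norm_minus_commute)
  assume fg: "f \<in> D" "g \<in> D"
  show "(cdist (fun_alg D S) f g = 0) = (f = g)"
    using fg N.norm_eq_zero[of "\<lambda>x. f x - g x"]
    by (simp add: cdist_fun_alg diff_mem) (auto simp: fun_eq_iff)
  assume h: "h \<in> D"
  show "cdist (fun_alg D S) f h \<le> cdist (fun_alg D S) f g + cdist (fun_alg D S) g h"
    using fg h N.norm_triangle[of "\<lambda>x. f x - g x" "\<lambda>x. g x - h x"]
    by (simp add: cdist_fun_alg diff_mem)
qed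

text \<open>
  The balls of the supremum norm are described by strict pointwise bounds only after halving the
  radius, since the supremum of \<open>\<bar>f - g\<bar>\<close> can equal a strict bound of all its values.
\<close>

lemma closure_of_fun_alg:
  assumes "T \<subseteq> D"
  shows "norm_topology (fun_alg D S) closure_of T =
    {f \<in> D. \<forall>e>0. \<exists>g\<in>T. \<forall>x. cmod (f x - g x) < e}" (is "?L = ?R")
proof -
  interpret M: Metric_space D "cdist (fun_alg D S)" by (rule Metric_space_fun_alg)
  have *: "(\<exists>g\<in>T. g \<in> M.mball f e)"
    if f: "f \<in> D" and e: "e > 0" and h: "\<forall>e>0. \<exists>g\<in>T. \<forall>x. cmod (f x - g x) < e" for f e
  proof -
    obtain g where g: "g \<in> T" "\<And>x. cmod (f x - g x) < e/2" using h e by (meson half_gt_zero)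
    have "sup_norm (\<lambda>x. f x - g x) \<le> e/2"
      by (rule sup_norm_le) (use g in \<open>auto intro: less_imp_le\<close>)
    then show ?thesis using g f e assms by (auto simp: cdist_fun_alg subset_iff intro!: bexI[of _ g])
  qed
  have **: "\<exists>g\<in>T. \<forall>x. cmod (f x - g x) < e" if "g \<in> T" "g \<in> M.mball f e" for f g e
  proof (intro bexI allI)
    fix x
    have fg: "f \<in> D" "g \<in> D" "sup_norm (\<lambda>x. f x - g x) < e"
      using that by (auto simp: cdist_fun_alg)
    show "cmod (f x - g x) < e"
      using norm_le_sup_norm[OF bounded_mem[OF diff_mem[OF fg(1,2)]], of x] fg(3) by simp
  qed fact
  show ?thesis
    unfolding norm_topology_def fun_alg_simps M.metric_closure_of
    using * ** by fastforce
qed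

end

locale uniform_algebra = function_star_algebra +
  assumes uniform_limit_mem:
    "\<lbrakk>\<And>n. F n \<in> D; uniform_limit UNIV F f sequentially\<rbrakk> \<Longrightarrow> f \<in> D"
begin

lemma cstar_algebra_fun_alg: "cstar_algebra (fun_alg D S)"
proof -
  interpret M: Metric_space D "cdist (fun_alg D S)" by (rule Metric_space_fun_alg)
  have "\<exists>f. limitin M.mtopology F f sequentially" if "M.MCauchy F" for F
  proof -
    have FD: "F n \<in> D" for n using that by (auto simp: M.MCauchy_def)
    have close: "cmod (F m x - F n x) \<le> cdist (fun_alg D S) (F m) (F n)" for m n x
      using norm_le_sup_norm[OF bounded_mem[OF diff_mem[OF FD FD]]] by (simp add: cdist_fun_alg FD)
    have "uniformly_Cauchy_on UNIV F"
      unfolding uniformly_Cauchy_on_def dist_norm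
      using that close unfolding M.MCauchy_def by (meson le_less_trans)
    then obtain f where f: "uniform_limit UNIV F f sequentially"
      using Cauchy_uniformly_convergent unfolding uniformly_convergent_on_def by blast
    have fD: "f \<in> D" by (rule uniform_limit_mem[OF FD f])
    have "limitin M.mtopology F f sequentially"
      unfolding M.limitin_metric
    proof (intro conjI allI impI fD)
      fix e :: real assume e: "0 < e"
      then have "\<forall>\<^sub>F n in sequentially. \<forall>x. dist (F n x) (f x) < e/2"
        using uniform_limitD[OF f, of "e/2"] by simp
      then show "\<forall>\<^sub>F n in sequentially. F n \<in> D \<and> cdist (fun_alg D S) (F n) f < e"
      proof eventually_elim
        case (elim n)
        then have "sup_norm (\<lambda>x. F n x - f x) \<le> e/2"
          by (intro sup_norm_le) (auto simp: dist_norm intro: less_imp_le)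
        then show ?case using e FD fD by (auto simp: cdist_fun_alg)
      qed
    qed
    then show ?thesis by blast
  qed
  then have "Metric_space.mcomplete (carrier (fun_alg D S)) (cdist (fun_alg D S))"
    by (simp add: M.mcomplete_def)
  then show ?thesis
    by (intro cstar_algebra.intro cstar_algebra_axioms.intro) (simp_all add: cstar_norm_fun_alg)
qed

end


section \<open>Spans of elementary tensors\<close>

lemma (in function_star_algebra) sum_mem:
  "(\<And>i. i \<in> I \<Longrightarrow> f i \<in> D) \<Longrightarrow> (\<lambda>x. \<Sum>i\<in>I. f i x) \<in> D"
  by (induction I rule: infinite_finite_induct) (simp_all add: zero_mem add_mem)

definition uniform_closure :: "('x \<Rightarrow> complex) set \<Rightarrow> ('x \<Rightarrow> complex) set"
  where "uniform_closure T = {f. \<forall>e>0. \<exists>g\<in>T. \<forall>x. cmod (f x - g x) < e}"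

lemma subset_uniform_closure: "T \<subseteq> uniform_closure T"
  unfolding uniform_closure_def by (auto intro!: bexI)

text \<open>
  Closedness under the algebraic operations is inherited through convergent sequences, whereas
  idempotence of the closure is an \<open>\<epsilon>/2\<close> argument; hence both descriptions of the closure.
\<close>

lemma mem_uniform_closure_iff:
  "f \<in> uniform_closure T \<longleftrightarrow> (\<exists>F. (\<forall>n. F n \<in> T) \<and> uniform_limit UNIV F f sequentially)"
proof
  assume f: "f \<in> uniform_closure T"
  have "\<exists>g\<in>T. \<forall>x. cmod (f x - g x) < inverse (real (Suc n))" for n
    using f unfolding uniform_closure_def by simp
  then obtain F where F: "\<And>n. F n \<in> T" "\<And>n x. cmod (f x - F n x) < inverse (real (Suc n))"
    by metis
  have "uniform_limit UNIV F f sequentially"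
    unfolding uniform_limit_sequentially_iff
  proof (intro allI impI)
    fix e :: real assume "0 < e"
    then obtain N where N: "inverse (real (Suc N)) < e" using reals_Archimedean by blast
    have "dist (F n x) (f x) < e" if "N \<le> n" for n x
    proof -
      have "inverse (real (Suc n)) \<le> inverse (real (Suc N))" using that by simp
      then show ?thesis using F(2)[of x n] N unfolding dist_norm norm_minus_commute[of "F n x"] by linarith
    qed
    then show "\<exists>N. \<forall>n\<ge>N. \<forall>x\<in>UNIV. dist (F n x) (f x) < e" by blast
  qed
  with F(1) show "\<exists>F. (\<forall>n. F n \<in> T) \<and> uniform_limit UNIV F f sequentially" by blast
next
  assume "\<exists>F. (\<forall>n. F n \<in> T) \<and> uniform_limit UNIV F f sequentially"
  then obtain F where F: "\<And>n. F n \<in> T" "uniform_limit UNIV F f sequentially" by blast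
  show "f \<in> uniform_closure T"
    unfolding uniform_closure_def
  proof (intro CollectI allI impI)
    fix e :: real assume "0 < e"
    then obtain n where "\<And>x. dist (F n x) (f x) < e"
      using F(2) unfolding uniform_limit_sequentially_iff by blast
    then show "\<exists>g\<in>T. \<forall>x. cmod (f x - g x) < e"
      using F(1)[of n] by (auto simp: dist_norm norm_minus_commute intro!: bexI[of _ "F n"])
  qed
qed

lemma uniform_closureE:
  assumes "f \<in> uniform_closure T"
  obtains F where "\<And>n. F n \<in> T" "uniform_limit UNIV F f sequentially"
  using assms unfolding mem_uniform_closure_iff by (elim exE conjE) (rule that, auto)

lemma uniform_closureI:
  "\<lbrakk>\<And>n. F n \<in> T; uniform_limit UNIV F f sequentially\<rbrakk> \<Longrightarrow> f \<in> uniform_closure T"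
  unfolding mem_uniform_closure_iff by (rule exI[of _ F]) simp

lemma (in function_star_algebra) bounded_uniform_closure:
  assumes "f \<in> uniform_closure D"
  shows "bounded (range f)"
proof -
  obtain g where g: "g \<in> D" "\<And>x. cmod (f x - g x) < 1"
    using assms unfolding uniform_closure_def by (auto dest: spec[of _ 1])
  have "cmod (f x) \<le> sup_norm g + 1" for x
    using norm_le_sup_norm[OF bounded_mem[OF g(1)], of x] g(2)[of x]
      norm_triangle_ineq2[of "f x" "g x"] by simp
  then show ?thesis unfolding bounded_iff by auto
qed

lemma (in function_star_algebra) uniform_algebra_uniform_closure:
  "uniform_algebra (uniform_closure D)"
proof (intro uniform_algebra.intro function_star_algebra.intro uniform_algebra_axioms.intro)
  show "(\<lambda>x. 0) \<in> uniform_closure D"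
    using zero_mem subset_uniform_closure by blast
  fix f assume f: "f \<in> uniform_closure D"
  then show bf: "bounded (range f)" by (rule bounded_uniform_closure)
  obtain F where F: "\<And>n. F n \<in> D" "uniform_limit UNIV F f sequentially"
    by (rule uniform_closureE[OF f]) blast
  show "(\<lambda>x. c * f x) \<in> uniform_closure D" for c
    by (rule uniform_closureI[OF smult_mem[OF F(1)]
        bounded_linear.uniform_limit[OF bounded_linear_mult_right F(2)]])
  show "(\<lambda>x. cnj (f x)) \<in> uniform_closure D"
    by (rule uniform_closureI[OF cnj_mem[OF F(1)]
        bounded_linear.uniform_limit[OF bounded_linear_cnj F(2)]])
  fix g assume g: "g \<in> uniform_closure D"
  obtain G where G: "\<And>n. G n \<in> D" "uniform_limit UNIV G g sequentially"
    by (rule uniform_closureE[OF g]) blast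
  show "(\<lambda>x. f x + g x) \<in> uniform_closure D"
    by (rule uniform_closureI[OF add_mem[OF F(1) G(1)] uniform_limit_add[OF F(2) G(2)]])
  show "(\<lambda>x. f x * g x) \<in> uniform_closure D"
    by (rule uniform_closureI[OF mult_mem[OF F(1) G(1)]
        uniform_lim_mult[OF F(2) G(2) bf bounded_uniform_closure[OF g]]])
next
  fix F :: "nat \<Rightarrow> 'x \<Rightarrow> complex" and f
  assume "\<And>n. F n \<in> uniform_closure D" "uniform_limit UNIV F f sequentially"
  then have f: "f \<in> uniform_closure (uniform_closure D)"
    by (rule uniform_closureI)
  show "f \<in> uniform_closure D"
    unfolding uniform_closure_def
  proof (intro CollectI allI impI)
    fix e :: real assume e: "0 < e"
    then obtain g where g: "g \<in> uniform_closure D" "\<And>x. cmod (f x - g x) < e/2"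
      using f unfolding uniform_closure_def[of "uniform_closure D"] by (auto dest: spec[of _ "e/2"])
    then obtain h where h: "h \<in> D" "\<And>x. cmod (g x - h x) < e/2"
      using e unfolding uniform_closure_def by (auto dest: spec[of _ "e/2"])
    have "cmod (f x - h x) < e" for x
      using norm_diff_triangle_less[OF g(2) h(2)] by simp
    with h(1) show "\<exists>g\<in>D. \<forall>x. cmod (f x - g x) < e" by blast
  qed
qed

definition tensor_fun :: "('x \<Rightarrow> complex) \<Rightarrow> ('y \<Rightarrow> complex) \<Rightarrow> 'x \<times> 'y \<Rightarrow> complex"
  where "tensor_fun a b = (\<lambda>z. a (fst z) * b (snd z))"

inductive_set tensor_span :: "('x \<Rightarrow> complex) set \<Rightarrow> ('y \<Rightarrow> complex) set \<Rightarrow> ('x \<times> 'y \<Rightarrow> complex) set"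
  for A :: "('x \<Rightarrow> complex) set" and B :: "('y \<Rightarrow> complex) set"
  where
    zero: "(\<lambda>z. 0) \<in> tensor_span A B"
  | add: "\<lbrakk>a \<in> A; b \<in> B; h \<in> tensor_span A B\<rbrakk> \<Longrightarrow> (\<lambda>z. tensor_fun a b z + h z) \<in> tensor_span A B"

lemma tensor_fun_mem_span: "\<lbrakk>a \<in> A; b \<in> B\<rbrakk> \<Longrightarrow> tensor_fun a b \<in> tensor_span A B"
  using tensor_span.add[OF _ _ tensor_span.zero] by simp

lemma tensor_span_add:
  "\<lbrakk>g \<in> tensor_span A B; h \<in> tensor_span A B\<rbrakk> \<Longrightarrow> (\<lambda>z. g z + h z) \<in> tensor_span A B"
proof (induction rule: tensor_span.induct)
  case (add a b g)
  then show ?case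
    using tensor_span.add[OF add.hyps(1,2) add.IH] by (simp add: add.assoc)
qed simp

lemma function_star_algebra_tensor_span:
  assumes "function_star_algebra A" "function_star_algebra B"
  shows "function_star_algebra (tensor_span A B)"
proof -
  interpret A: function_star_algebra A by fact
  interpret B: function_star_algebra B by fact
  have mult1: "(\<lambda>z. tensor_fun a b z * h z) \<in> tensor_span A B"
    if "h \<in> tensor_span A B" "a \<in> A" "b \<in> B" for a b h
    using that
  proof (induction rule: tensor_span.induct)
    case (add a' b' h)
    have "(\<lambda>z. tensor_fun (\<lambda>x. a x * a' x) (\<lambda>y. b y * b' y) z + tensor_fun a b z * h z) \<in> tensor_span A B"
      using add by (intro tensor_span.add A.mult_mem B.mult_mem) auto
    then show ?case by (simp add: tensor_fun_def algebra_simps)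
  qed (simp add: tensor_span.zero)
  show ?thesis
  proof
    show "(\<lambda>z. 0) \<in> tensor_span A B" by (rule tensor_span.zero)
    fix f assume f: "f \<in> tensor_span A B"
    show "(\<lambda>z. c * f z) \<in> tensor_span A B" for c
      using f
    proof (induction rule: tensor_span.induct)
      case (add a b h)
      have "(\<lambda>z. tensor_fun (\<lambda>x. c * a x) b z + c * h z) \<in> tensor_span A B"
        using add by (intro tensor_span.add A.smult_mem) auto
      then show ?case by (simp add: tensor_fun_def algebra_simps)
    qed (simp add: tensor_span.zero)
    show "(\<lambda>z. cnj (f z)) \<in> tensor_span A B"
      using f
    proof (induction rule: tensor_span.induct)
      case (add a b h)
      have "(\<lambda>z. tensor_fun (\<lambda>x. cnj (a x)) (\<lambda>y. cnj (b y)) z + cnj (h z)) \<in> tensor_span A B"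
        using add by (intro tensor_span.add A.cnj_mem B.cnj_mem) auto
      then show ?case by (simp add: tensor_fun_def)
    qed (simp add: tensor_span.zero)
    show "bounded (range f)"
      using f
    proof (induction rule: tensor_span.induct)
      case (add a b h)
      have "cmod (tensor_fun a b z + h z) \<le> sup_norm a * sup_norm b + sup_norm h" for z
        unfolding tensor_fun_def
        using norm_le_sup_norm[OF A.bounded_mem] norm_le_sup_norm[OF B.bounded_mem] add
        by (intro order_trans[OF norm_triangle_ineq] add_mono)
          (auto simp: norm_mult norm_le_sup_norm intro!: mult_mono sup_norm_nonneg A.bounded_mem)
      then show ?case unfolding bounded_iff by auto
    qed auto
    fix g assume g: "g \<in> tensor_span A B"
    show "(\<lambda>z. f z + g z) \<in> tensor_span A B"
      using f g by (rule tensor_span_add)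
    show "(\<lambda>z. f z * g z) \<in> tensor_span A B"
      using f
    proof (induction rule: tensor_span.induct)
      case (add a b h)
      then show ?case
        using tensor_span_add[OF mult1[OF g add.hyps(1,2)] add.IH] by (simp add: algebra_simps)
    qed (simp add: tensor_span.zero)
  qed
qed

text \<open>
  \<^const>\<open>tensor_lift\<close> sums in the abelian group of the algebra, where a sum has a specified value only
  if every summand lies in the carrier.
\<close>

lemma tensor_lift_fun_alg:
  assumes "function_star_algebra E"
    and "\<And>a b. (a, b) \<in> Poly_Mapping.keys u \<Longrightarrow> tensor_fun a b \<in> E"
  shows "tensor_lift (fun_alg E S) tensor_fun u =
    (\<lambda>z. \<Sum>p\<in>Poly_Mapping.keys u. Poly_Mapping.lookup u p * tensor_fun (fst p) (snd p) z)"
proof -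
  interpret E: function_star_algebra E by fact
  interpret abelian_group "fun_alg E S" by (rule E.abelian_group_fun_alg)
  have "finsum (fun_alg E S) G K = (\<lambda>z. \<Sum>p\<in>K. G p z)" if "finite K" "\<And>p. p \<in> K \<Longrightarrow> G p \<in> E"
    for G :: "'d \<Rightarrow> _" and K
    using that
  proof (induction K)
    case (insert p K)
    then show ?case by (subst finsum_insert) auto
  qed simp
  from this[OF finite_keys, of u "\<lambda>p z. Poly_Mapping.lookup u p * tensor_fun (fst p) (snd p) z"]
  show ?thesis
    unfolding tensor_lift_def using assms(2) by (simp add: E.smult_mem split_paired_all)
qed

lemma sum_keys_add:
  fixes u v :: "'p \<Rightarrow>\<^sub>0 complex"
  shows "(\<Sum>p\<in>Poly_Mapping.keys (u + v). Poly_Mapping.lookup (u + v) p * g p) =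
    (\<Sum>p\<in>Poly_Mapping.keys u. Poly_Mapping.lookup u p * g p) +
    (\<Sum>p\<in>Poly_Mapping.keys v. Poly_Mapping.lookup v p * g p)"
proof -
  let ?K = "Poly_Mapping.keys u \<union> Poly_Mapping.keys v"
  have "(\<Sum>p\<in>Poly_Mapping.keys w. Poly_Mapping.lookup w p * g p) = (\<Sum>p\<in>?K. Poly_Mapping.lookup w p * g p)"
    if "Poly_Mapping.keys w \<subseteq> ?K" for w
    using that by (intro sum.mono_neutral_left) (auto simp: in_keys_iff)
  from this[of u] this[of v] this[OF keys_add] show ?thesis
    by (simp add: lookup_add distrib_right sum.distrib)
qed

lemma tensor_lift_image:
  assumes "function_star_algebra A" "function_star_algebra B"
    and E: "function_star_algebra E" "tensor_span A B \<subseteq> E"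
  shows "tensor_lift (fun_alg E U) tensor_fun ` formal_sums (fun_alg A S) (fun_alg B T) = tensor_span A B"
proof -
  interpret AB: function_star_algebra "tensor_span A B"
    by (rule function_star_algebra_tensor_span) fact+
  have lift: "tensor_lift (fun_alg E U) tensor_fun u =
      (\<lambda>z. \<Sum>p\<in>Poly_Mapping.keys u. Poly_Mapping.lookup u p * tensor_fun (fst p) (snd p) z)"
    if "u \<in> formal_sums (fun_alg A S) (fun_alg B T)" for u
    using that E tensor_fun_mem_span[of _ A _ B]
    by (intro tensor_lift_fun_alg) (auto simp: formal_sums_def)
  show ?thesis
  proof (intro equalityI subsetI)
    fix h assume "h \<in> tensor_lift (fun_alg E U) tensor_fun ` formal_sums (fun_alg A S) (fun_alg B T)"
    then obtain u where u: "u \<in> formal_sums (fun_alg A S) (fun_alg B T)"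
      and h: "h = tensor_lift (fun_alg E U) tensor_fun u" by blast
    have "(\<lambda>z. \<Sum>p\<in>K. c p * tensor_fun (fst p) (snd p) z) \<in> tensor_span A B"
      if "finite K" "K \<subseteq> A \<times> B" for K and c :: "_ \<Rightarrow> complex"
      using that
    proof (induction K)
      case (insert p K)
      then show ?case
        by (auto intro!: AB.add_mem AB.smult_mem tensor_fun_mem_span)
    qed (simp add: AB.zero_mem)
    then show "h \<in> tensor_span A B"
      using u unfolding h lift[OF u] by (auto simp: formal_sums_def)
  next
    fix h assume "h \<in> tensor_span A B"
    then show "h \<in> tensor_lift (fun_alg E U) tensor_fun ` formal_sums (fun_alg A S) (fun_alg B T)"
    proof (induction rule: tensor_span.induct)
      case zero
      have "0 \<in> formal_sums (fun_alg A S) (fun_alg B T)" by (simp add: formal_sums_def)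
      then show ?case using lift by force
    next
      case (add a b h)
      then obtain u where u: "u \<in> formal_sums (fun_alg A S) (fun_alg B T)"
        and h: "h = tensor_lift (fun_alg E U) tensor_fun u" by blast
      let ?v = "Poly_Mapping.single (a, b) 1 + u"
      have v: "?v \<in> formal_sums (fun_alg A S) (fun_alg B T)"
        using u add keys_add[of "Poly_Mapping.single (a, b) 1" u]
        by (auto simp: formal_sums_def split: if_splits)
      have "(\<lambda>z. tensor_fun a b z + h z) = tensor_lift (fun_alg E U) tensor_fun ?v"
        unfolding lift[OF v] h lift[OF u] by (simp add: sum_keys_add)
      then show ?case using v by blast
    qed
  qed
qed

section \<open>Injectivity of the map from formal sums to functions\<close>

lemma tensor_relations_uminus:
  "u \<in> tensor_relations A B \<Longrightarrow> - u \<in> tensor_relations A B"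
proof (induction rule: tensor_relations.induct)
  case (add u v)
  then show ?case using tensor_relations.add by fastforce
next
  case (add_left a a' b c)
  then show ?case
    using tensor_relations.add_left[of a A a' b B "-c"] by (simp add: single_uminus algebra_simps)
next
  case (add_right a b b' c)
  then show ?case
    using tensor_relations.add_right[of a A b B b' "-c"] by (simp add: single_uminus algebra_simps)
next
  case (smult_left a b r c)
  then show ?case
    using tensor_relations.smult_left[of a A b B r "-c"] by (simp add: single_uminus algebra_simps)
next
  case (smult_right a b r c)
  then show ?case
    using tensor_relations.smult_right[of a A b B r "-c"] by (simp add: single_uminus algebra_simps)
qed (simp add: tensor_relations.zero)

lemma tensor_relations_diff:
  "\<lbrakk>u \<in> tensor_relations A B; v \<in> tensor_relations A B\<rbrakk> \<Longrightarrow> u - v \<in> tensor_relations A B"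
  using tensor_relations.add[OF _ tensor_relations_uminus, of u A B v] by simp

lemma tensor_relations_sum:
  "(\<And>i. i \<in> I \<Longrightarrow> u i \<in> tensor_relations A B) \<Longrightarrow> sum u I \<in> tensor_relations A B"
  by (induction I rule: infinite_finite_induct)
    (auto simp: tensor_relations.zero intro: tensor_relations.add)


lemma single_sum_right_mem_tensor_relations:
  assumes "function_star_algebra B" "a \<in> A" "finite I" "\<And>i. i \<in> I \<Longrightarrow> b i \<in> B"
  shows "Poly_Mapping.single (a, \<lambda>y. \<Sum>i\<in>I. b i y) 1 - (\<Sum>i\<in>I. Poly_Mapping.single (a, b i) 1)
    \<in> tensor_relations (fun_alg A S) (fun_alg B T)"
  using assms(3,4)
proof (induction I)
  case empty
  interpret B: function_star_algebra B by fact
  show ?case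
    using tensor_relations.smult_right[of a "fun_alg A S" "\<lambda>y. 0" "fun_alg B T" 0 1] assms(2) B.zero_mem
    by simp
next
  case (insert i I)
  interpret B: function_star_algebra B by fact
  have "(\<lambda>y. \<Sum>i\<in>I. b i y) \<in> B"
    using insert.prems by (intro B.sum_mem) auto
  then have "Poly_Mapping.single (a, \<lambda>y. b i y + (\<Sum>i\<in>I. b i y)) 1 - Poly_Mapping.single (a, b i) 1
      - Poly_Mapping.single (a, \<lambda>y. \<Sum>i\<in>I. b i y) 1 \<in> tensor_relations (fun_alg A S) (fun_alg B T)"
    using tensor_relations.add_right[of a "fun_alg A S" "b i" "fun_alg B T" "\<lambda>y. \<Sum>i\<in>I. b i y" 1]
      assms(2) insert.prems by simp
  from tensor_relations.add[OF this insert.IH] show ?case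
    using insert by (simp add: algebra_simps)
qed

text \<open>
  A scalar moves across the tensor sign because both sides agree with the scalar put in front of
  the formal elementary tensor.
\<close>

lemma single_move_scalar_mem_tensor_relations:
  assumes "a \<in> A" "b \<in> B"
  shows "Poly_Mapping.single (a, \<lambda>y. r * b y) 1 - Poly_Mapping.single (\<lambda>x. r * a x, b) 1
    \<in> tensor_relations (fun_alg A S) (fun_alg B T)"
  using tensor_relations_diff[OF
      tensor_relations.smult_right[of a "fun_alg A S" b "fun_alg B T" r 1]
      tensor_relations.smult_left[of a "fun_alg A S" b "fun_alg B T" r 1]] assms
  by simp

text \<open>
  Induction on the number of terms. If \<open>a n\<close> is the zero function, its term is a relation by itself.
  Otherwise evaluation at a point \<open>x0\<close> with \<open>a n x0 \<noteq> 0\<close> solves the vanishing sum for \<open>b n\<close>, which is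
  thus a combination \<open>\<Sum> r i b i\<close> of the other right factors. Substituting it and moving the scalars to
  the left replaces the \<open>a i\<close> by \<open>a i + r i a n\<close> and removes one term, without changing the sum of
  the products.
\<close>

lemma sum_single_mem_tensor_relations:
  assumes A: "function_star_algebra A" and B: "function_star_algebra B"
    and "finite I" "\<And>i. i \<in> I \<Longrightarrow> a i \<in> A" "\<And>i. i \<in> I \<Longrightarrow> b i \<in> B"
    and "\<And>x y. (\<Sum>i\<in>I. a i x * b i y) = 0"
  shows "(\<Sum>i\<in>I. Poly_Mapping.single (a i, b i) 1) \<in> tensor_relations (fun_alg A S) (fun_alg B T)"
  using assms(3-)
proof (induction I arbitrary: a)
  case empty
  then show ?case by (simp add: tensor_relations.zero)
next
  case (insert n I)
  interpret A: function_star_algebra A by fact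
  interpret B: function_star_algebra B by fact
  let ?R = "tensor_relations (fun_alg A S) (fun_alg B T)"
  have an: "a n \<in> A" and bn: "b n \<in> B" using insert.prems by auto
  show ?case
  proof (cases "\<exists>x0. a n x0 \<noteq> 0")
    case False
    then have a0: "a n = (\<lambda>x. 0)" by auto
    have "(\<Sum>i\<in>I. Poly_Mapping.single (a i, b i) 1) \<in> ?R"
      using insert.prems insert.hyps a0 by (intro insert.IH) auto
    moreover have "Poly_Mapping.single (a n, b n) 1 \<in> ?R"
      using tensor_relations.smult_left[of "a n" "fun_alg A S" "b n" "fun_alg B T" 0 1] an bn a0 by simp
    ultimately show ?thesis
      using insert.hyps by (simp add: tensor_relations.add)
  next
    case True
    then obtain x0 where x0: "a n x0 \<noteq> 0" ..
    define r where "r i = - (a i x0 / a n x0)" for i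
    have bn_eq: "b n = (\<lambda>y. \<Sum>i\<in>I. r i * b i y)"
    proof
      fix y
      have "a n x0 * b n y + (\<Sum>i\<in>I. a i x0 * b i y) = 0"
        using insert.prems(3)[of x0 y] insert.hyps by simp
      then have "b n y = - (\<Sum>i\<in>I. a i x0 * b i y) / a n x0"
        using x0 by (simp add: field_simps add_eq_0_iff)
      also have "\<dots> = (\<Sum>i\<in>I. r i * b i y)"
        by (simp add: r_def sum_divide_distrib sum_negf)
      finally show "b n y = (\<Sum>i\<in>I. r i * b i y)" .
    qed
    let ?s = "\<lambda>f g. Poly_Mapping.single (f, g) (1::complex)"
    have "?s (a n) (b n) - (\<Sum>i\<in>I. ?s (a n) (\<lambda>y. r i * b i y)) \<in> ?R"
      unfolding bn_eq using insert.prems insert.hyps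
      by (intro single_sum_right_mem_tensor_relations B an B.smult_mem) auto
    moreover have "(\<Sum>i\<in>I. ?s (a n) (\<lambda>y. r i * b i y) - ?s (\<lambda>x. r i * a n x) (b i)) \<in> ?R"
      using insert.prems
      by (intro tensor_relations_sum single_move_scalar_mem_tensor_relations an) auto
    moreover have "(\<Sum>i\<in>I. ?s (a i) (b i) + ?s (\<lambda>x. r i * a n x) (b i)
        - ?s (\<lambda>x. a i x + r i * a n x) (b i)) \<in> ?R"
    proof (rule tensor_relations_sum)
      fix i assume "i \<in> I"
      then have "- (?s (\<lambda>x. a i x + r i * a n x) (b i) - ?s (a i) (b i)
          - ?s (\<lambda>x. r i * a n x) (b i)) \<in> ?R"
        using tensor_relations.add_left[of "a i" "fun_alg A S" "\<lambda>x. r i * a n x" "b i" "fun_alg B T" 1]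
          insert.prems an by (intro tensor_relations_uminus) (simp add: A.smult_mem)
      then show "?s (a i) (b i) + ?s (\<lambda>x. r i * a n x) (b i) - ?s (\<lambda>x. a i x + r i * a n x) (b i) \<in> ?R"
        by (simp add: algebra_simps)
    qed
    moreover have "(\<Sum>i\<in>I. ?s (\<lambda>x. a i x + r i * a n x) (b i)) \<in> ?R"
    proof (rule insert.IH)
      fix x y
      have "(\<Sum>i\<in>I. (a i x + r i * a n x) * b i y) = (\<Sum>i\<in>I. a i x * b i y) + a n x * b n y"
        unfolding bn_eq by (simp add: sum_distrib_left sum.distrib algebra_simps)
      also have "\<dots> = 0"
        using insert.prems(3)[of x y] insert.hyps by (simp add: add.commute)
      finally show "(\<Sum>i\<in>I. (a i x + r i * a n x) * b i y) = 0" .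
    next
      show "(\<lambda>x. a i x + r i * a n x) \<in> A" if "i \<in> I" for i
        using insert.prems(1)[of i] that by (intro A.add_mem A.smult_mem an) auto
    qed (use insert.prems in auto)
    \<comment> \<open>The four relations telescope to the sum over \<open>insert n I\<close>.\<close>
    ultimately have "(?s (a n) (b n) - (\<Sum>i\<in>I. ?s (a n) (\<lambda>y. r i * b i y)))
        + (\<Sum>i\<in>I. ?s (a n) (\<lambda>y. r i * b i y) - ?s (\<lambda>x. r i * a n x) (b i))
        + (\<Sum>i\<in>I. ?s (a i) (b i) + ?s (\<lambda>x. r i * a n x) (b i)
          - ?s (\<lambda>x. a i x + r i * a n x) (b i))
        + (\<Sum>i\<in>I. ?s (\<lambda>x. a i x + r i * a n x) (b i)) \<in> ?R"
      by (intro tensor_relations.add)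
    then show ?thesis
      using insert.hyps by (simp add: sum.distrib sum_subtractf)
  qed
qed

text \<open>
  Coefficients are first absorbed into the left factors, so that the previous lemma, in which all
  coefficients are \<open>1\<close>, applies.
\<close>

lemma tensor_lift_injective:
  assumes A: "function_star_algebra A" and B: "function_star_algebra B"
    and E: "function_star_algebra E" "tensor_span A B \<subseteq> E"
    and u: "u \<in> formal_sums (fun_alg A S) (fun_alg B T)"
    and 0: "tensor_lift (fun_alg E U) tensor_fun u = (\<lambda>z. 0)"
  shows "u \<in> tensor_relations (fun_alg A S) (fun_alg B T)"
proof -
  interpret A: function_star_algebra A by fact
  let ?R = "tensor_relations (fun_alg A S) (fun_alg B T)"
  let ?K = "Poly_Mapping.keys u" and ?c = "Poly_Mapping.lookup u"
  have K: "?K \<subseteq> A \<times> B" using u by (simp add: formal_sums_def)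
  have sum0: "(\<Sum>p\<in>?K. ?c p * tensor_fun (fst p) (snd p) z) = 0" for z
    using 0 K E tensor_fun_mem_span[of _ A _ B]
    by (subst (asm) tensor_lift_fun_alg) (auto dest: fun_cong[of _ _ z])
  have u_eq: "u = (\<Sum>p\<in>?K. Poly_Mapping.single p (?c p))"
    by (rule poly_mapping_eqI) (auto simp: lookup_sum lookup_single when_def in_keys_iff)
  have "(\<Sum>p\<in>?K. Poly_Mapping.single (\<lambda>x. ?c p * fst p x, snd p) 1) \<in> ?R"
    using K sum0 by (intro sum_single_mem_tensor_relations A B)
      (auto simp: tensor_fun_def mult.assoc intro!: A.smult_mem)
  moreover have "(\<Sum>p\<in>?K. Poly_Mapping.single (\<lambda>x. ?c p * fst p x, snd p) 1
      - Poly_Mapping.single p (?c p)) \<in> ?R"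
  proof (rule tensor_relations_sum)
    fix p assume "p \<in> ?K"
    then show "Poly_Mapping.single (\<lambda>x. ?c p * fst p x, snd p) 1 - Poly_Mapping.single p (?c p) \<in> ?R"
      using K tensor_relations.smult_left[of "fst p" "fun_alg A S" "snd p" "fun_alg B T" "?c p" 1]
      by auto
  qed
  ultimately show ?thesis
    using tensor_relations_diff[of _ "fun_alg A S" "fun_alg B T"] u_eq
    by (fastforce simp: sum_subtractf)
qed


section \<open>Bounded continuous functions\<close>

text \<open>
  The functions vanish off the space, in accordance with \<^const>\<open>fun_alg\<close>. With its unit
  \<open>indicator (topspace X)\<close> this is the C*-algebra of the Stone-Cech compactification of \<open>X\<close>; working
  with functions on \<open>X\<close> avoids that compactification.
\<close>

definition Cb :: "'x topology \<Rightarrow> ('x \<Rightarrow> complex) set"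
  where "Cb X = {f. continuous_map X euclidean f \<and> bounded (range f) \<and> (\<forall>x. x \<notin> topspace X \<longrightarrow> f x = 0)}"

lemma CbI:
  assumes "continuous_map X euclidean f" "\<And>x. cmod (f x) \<le> B" "\<And>x. x \<notin> topspace X \<Longrightarrow> f x = 0"
  shows "f \<in> Cb X"
  using assms unfolding Cb_def bounded_iff by auto

lemma uniform_algebra_Cb: "uniform_algebra (Cb X)"
proof (intro uniform_algebra.intro function_star_algebra.intro uniform_algebra_axioms.intro)
  show "(\<lambda>x. 0) \<in> Cb X" by (auto simp: Cb_def)
  fix f assume f: "f \<in> Cb X"
  then have bf: "bounded (range f)" by (simp add: Cb_def)
  then show "bounded (range f)" .
  note nf = norm_le_sup_norm[OF bf]
  show "(\<lambda>x. c * f x) \<in> Cb X" for c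
    using f nf by (intro CbI[where B = "cmod c * sup_norm f"])
      (auto simp: Cb_def continuous_map_atin norm_mult intro!: tendsto_intros mult_left_mono)
  show "(\<lambda>x. cnj (f x)) \<in> Cb X"
    using f nf by (intro CbI[where B = "sup_norm f"])
      (auto simp: Cb_def continuous_map_atin intro!: tendsto_intros)
  fix g assume g: "g \<in> Cb X"
  then have bg: "bounded (range g)" by (simp add: Cb_def)
  note ng = norm_le_sup_norm[OF bg]
  show "(\<lambda>x. f x + g x) \<in> Cb X"
    using f g nf ng by (intro CbI[where B = "sup_norm f + sup_norm g"])
      (auto simp: Cb_def continuous_map_atin intro!: tendsto_intros order_trans[OF norm_triangle_ineq] add_mono)
  show "(\<lambda>x. f x * g x) \<in> Cb X"
    using f g nf ng sup_norm_nonneg[OF bf]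
    by (intro CbI[where B = "sup_norm f * sup_norm g"])
      (auto simp: Cb_def continuous_map_atin norm_mult intro!: tendsto_intros mult_mono)
next
  fix F :: "nat \<Rightarrow> 'a \<Rightarrow> complex" and f
  assume F: "\<And>n. F n \<in> Cb X" and lim: "uniform_limit UNIV F f sequentially"
  have "\<forall>\<^sub>F n in sequentially. \<forall>x. dist (F n x) (f x) < 1"
    using uniform_limitD[OF lim, of 1] by simp
  then obtain n where n: "\<And>x. dist (F n x) (f x) < 1"
    using eventually_happens'[OF sequentially_bot] by blast
  have bF: "bounded (range (F n))" using F[of n] by (simp add: Cb_def)
  show "f \<in> Cb X"
  proof (rule CbI)
    show "continuous_map X euclidean f"
    proof (rule Met_TC.continuous_map_uniform_limit[where F = sequentially and f = F, simplified])
      show "\<forall>\<^sub>F n in sequentially. \<forall>x\<in>topspace X. dist (F n x) (f x) < e" if "0 < e" for e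
        using uniform_limitD[OF lim that] by (rule eventually_mono) simp
    qed (use F in \<open>auto simp: Cb_def\<close>)
    show "cmod (f x) \<le> sup_norm (F n) + 1" for x
      using norm_le_sup_norm[OF bF, of x] n[of x] norm_triangle_ineq3[of "F n x" "f x"]
      by (simp add: dist_norm)
    fix x assume "x \<notin> topspace X"
    then have "(\<lambda>n. F n x) = (\<lambda>n. 0)" using F by (simp add: Cb_def)
    moreover have "(\<lambda>n. F n x) \<longlonglongrightarrow> f x" by (rule tendsto_uniform_limitI[OF lim]) simp
    ultimately show "f x = 0" by (simp add: LIMSEQ_const_iff)
  qed
qed

interpretation Cb: uniform_algebra "Cb X" for X
  by (rule uniform_algebra_Cb)

lemma real_function_mem_Cb:
  assumes "continuous_map X euclideanreal \<phi>" "\<And>x. x \<in> topspace X \<Longrightarrow> \<bar>\<phi> x\<bar> \<le> B"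
  shows "(\<lambda>x. if x \<in> topspace X then complex_of_real (\<phi> x) else 0) \<in> Cb X"
proof (rule CbI[where B = "max B 0"])
  have "continuous_map X euclidean (\<lambda>x. complex_of_real (\<phi> x))"
    using assms(1) by (auto simp: continuous_map_atin intro!: tendsto_intros)
  then show "continuous_map X euclidean (\<lambda>x. if x \<in> topspace X then complex_of_real (\<phi> x) else 0)"
    by (rule continuous_map_eq) simp
qed (use assms(2) in \<open>auto simp: le_max_iff_disj\<close>)

lemma indicator_topspace_mem_Cb: "indicator (topspace X) \<in> Cb X"
proof -
  have "indicator (topspace X) = (\<lambda>x. if x \<in> topspace X then complex_of_real 1 else 0)"
    by (auto simp: indicator_def)
  then show ?thesis using real_function_mem_Cb[of X "\<lambda>x. 1" 1] by simp
qed

text \<open>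
  A C*-seminorm takes values at most \<open>1\<close> on unitaries, because \<open>N u\<close> squared is \<open>N\<close> of the unit, a
  number that equals its own square. A real function \<open>a\<close> with values in \<open>[-1, 1]\<close> is the average of the unitaries
  \<open>a \<plusminus> \<i> sqrt (1 - a\<^sup>2)\<close>, which lie in the algebra because it contains all bounded continuous
  functions. A general \<open>f\<close> is reduced to the real function \<open>cnj f * f\<close> by the C*-identity.
\<close>

lemma cstar_seminorm_le_sup_norm:
  fixes N :: "('x \<Rightarrow> complex) \<Rightarrow> real"
  assumes nonneg: "\<And>f. f \<in> Cb X \<Longrightarrow> 0 \<le> N f"
    and triangle: "\<And>f g. \<lbrakk>f \<in> Cb X; g \<in> Cb X\<rbrakk> \<Longrightarrow> N (\<lambda>x. f x + g x) \<le> N f + N g"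
    and smult: "\<And>c f. f \<in> Cb X \<Longrightarrow> N (\<lambda>x. c * f x) = cmod c * N f"
    and star: "\<And>f. f \<in> Cb X \<Longrightarrow> N (\<lambda>x. cnj (f x) * f x) = (N f)\<^sup>2"
    and f: "f \<in> Cb X"
  shows "N f \<le> sup_norm f"
proof -
  let ?one = "indicator (topspace X) :: 'x \<Rightarrow> complex"
  have "(\<lambda>x. cnj (?one x) * ?one x) = ?one" by (auto simp: indicator_def)
  then have "N ?one = (N ?one)\<^sup>2" using star[OF indicator_topspace_mem_Cb] by simp
  then have N_one: "N ?one \<le> 1" by (auto simp: power2_eq_square)
  have unitary: "N u \<le> 1" if "u \<in> Cb X" "(\<lambda>x. cnj (u x) * u x) = ?one" for u
    using star[OF that(1)] that(2) N_one power2_le_imp_le[of "N u" 1] by simp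
  have real: "N a \<le> 1" if a: "a \<in> Cb X" "\<And>x. cnj (a x) = a x" "\<And>x. cmod (a x) \<le> 1" for a
  proof -
    define w where "w x = (if x \<in> topspace X then complex_of_real (sqrt (1 - (cmod (a x))\<^sup>2)) else 0)" for x
    have "continuous_map X euclideanreal (\<lambda>x. sqrt (1 - (cmod (a x))\<^sup>2))"
      using a(1) by (auto simp: Cb_def continuous_map_atin intro!: tendsto_intros)
    moreover have "\<bar>sqrt (1 - (cmod (a x))\<^sup>2)\<bar> \<le> 1" for x
      using a(3)[of x] by (simp add: power_le_one)
    ultimately have w: "w \<in> Cb X"
      unfolding w_def by (rule real_function_mem_Cb)
    have sq: "a x * a x + w x * w x = ?one x" for x
    proof (cases "x \<in> topspace X")
      case True
      have "a x * a x = complex_of_real ((cmod (a x))\<^sup>2)"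
        using complex_norm_square[of "a x"] a(2)[of x] by simp
      moreover have "w x * w x = complex_of_real (1 - (cmod (a x))\<^sup>2)"
        using True a(3)[of x] by (simp add: w_def power_le_one flip: of_real_mult)
      ultimately show ?thesis using True by simp
    next
      case False
      then show ?thesis using a(1) by (simp add: w_def Cb_def)
    qed
    have w_cnj: "cnj (w x) = w x" for x by (simp add: w_def)
    define u where "u s x = a x + s * w x" for s x
    have u: "u s \<in> Cb X" for s
      unfolding u_def by (intro Cb.add_mem Cb.smult_mem a w)
    have Nu: "N (u s) \<le> 1" if "s = \<i> \<or> s = - \<i>" for s
    proof (rule unitary[OF u])
      show "(\<lambda>x. cnj (u s x) * u s x) = ?one"
        using that sq by (auto simp: u_def a(2) w_cnj algebra_simps)
    qed
    have "N (\<lambda>x. u \<i> x + u (- \<i>) x) \<le> 2"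
      using triangle[OF u u, of \<i> "- \<i>"] Nu[of \<i>] Nu[of "- \<i>"] by simp
    moreover have "(\<lambda>x. u \<i> x + u (- \<i>) x) = (\<lambda>x. 2 * a x)" by (auto simp: u_def)
    ultimately show ?thesis using smult[OF a(1), of 2] by simp
  qed
  define M where "M = sup_norm f"
  have fM: "cmod (f x) \<le> M" for x
    unfolding M_def by (rule norm_le_sup_norm[OF Cb.bounded_mem[OF f]])
  have M0: "0 \<le> M" using fM norm_ge_zero order_trans by blast
  show ?thesis
  proof (cases "M = 0")
    case True
    then have "f = (\<lambda>x. 0)" using fM by (auto simp: fun_eq_iff)
    then show ?thesis using smult[OF f, of 0] by simp
  next
    case False
    define b where "b x = complex_of_real (1 / M\<^sup>2) * (cnj (f x) * f x)" for x
    have ff: "(\<lambda>x. cnj (f x) * f x) \<in> Cb X" by (intro Cb.mult_mem Cb.cnj_mem f)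
    have "N b \<le> 1"
    proof (rule real)
      show "b \<in> Cb X" unfolding b_def by (rule Cb.smult_mem[OF ff])
      show "cnj (b x) = b x" for x by (simp add: b_def)
      show "cmod (b x) \<le> 1" for x
        using fM[of x] False M0
        by (simp add: b_def norm_mult norm_divide norm_power field_simps power2_eq_square mult_mono)
    qed
    moreover have "N b = (N f)\<^sup>2 / M\<^sup>2"
      unfolding b_def smult[OF ff] star[OF f] using M0 by (simp add: norm_divide norm_power)
    ultimately have "(N f)\<^sup>2 \<le> M\<^sup>2" using False M0 by (simp add: field_simps)
    then show ?thesis using M0 unfolding M_def by (rule power2_le_imp_le)
  qed
qed

text \<open>
  Two nested bumps: \<open>c\<close> is a local unit for \<open>f\<close>. With a separating function \<open>\<phi>\<close> that is \<open>0\<close> at \<open>x\<close> and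
  \<open>1\<close> off \<open>U\<close>, the function \<open>f\<close> lives where \<open>\<phi> < 1/2\<close>, and there \<open>c\<close> equals \<open>1\<close>.
\<close>

lemma bump_functions:
  assumes "completely_regular_space X" "openin X U" "x \<in> U"
  obtains c f where "c \<in> Cb X" "f \<in> Cb X" "\<And>y. cmod (c y) \<le> 1" "\<And>y. y \<notin> U \<Longrightarrow> c y = 0"
    "\<And>y. c y * f y = f y" "f x = 1"
proof -
  have xX: "x \<in> topspace X" using assms(2,3) openin_subset by blast
  moreover have "closedin X (topspace X - U)" using assms(2) by blast
  ultimately obtain \<phi> :: "_ \<Rightarrow> real" where \<phi>: "continuous_map X (top_of_set {0..1}) \<phi>" "\<phi> x = 0"
    "\<phi> ` (topspace X - U) \<subseteq> {1}"
    using assms unfolding completely_regular_space_def by (metis DiffD2 DiffI)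
  have cont: "continuous_map X euclideanreal \<phi>"
    using \<phi>(1) by (simp add: continuous_map_in_subtopology)
  have range: "0 \<le> \<phi> y" "\<phi> y \<le> 1" if "y \<in> topspace X" for y
    using \<phi>(1) that by (auto simp: continuous_map_in_subtopology)
  define c where "c y = (if y \<in> topspace X then complex_of_real (min 1 (2 * (1 - \<phi> y))) else 0)" for y
  define f where "f y = (if y \<in> topspace X then complex_of_real (max 0 (1 - 2 * \<phi> y)) else 0)" for y
  show ?thesis
  proof
    show "c \<in> Cb X" unfolding c_def
      using cont range by (intro real_function_mem_Cb[where B = 1])
        (auto simp: continuous_map_atin intro!: tendsto_intros)
    show "f \<in> Cb X" unfolding f_def
      using cont range by (intro real_function_mem_Cb[where B = 1])
        (auto simp: continuous_map_atin intro!: tendsto_intros)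
    show "cmod (c y) \<le> 1" for y
      using range[of y] unfolding c_def by (auto simp del: of_real_mult)
    show "c y = 0" if "y \<notin> U" for y
      using \<phi>(3) that by (auto simp: c_def image_subset_iff)
    show "c y * f y = f y" for y
      by (auto simp: c_def f_def min_def max_def)
    show "f x = 1" using xX \<phi>(2) by (simp add: f_def)
  qed
qed

section \<open>Minimality of the supremum norm\<close>

text \<open>
  Throughout, \<open>\<nu>\<close> is a C*-norm on the algebraic tensor product of \<^term>\<open>Cb X\<close> and \<^term>\<open>Cb Y\<close>. The
  goal is \<open>\<bar>h z\<bar> \<le> \<nu> h\<close> at each point \<open>z\<close>. Near \<open>z\<close> the function \<open>h\<close> is almost constant, and this is
  true also for \<open>\<nu>\<close>: if \<open>k\<close> is an elementary tensor of functions supported close to \<open>z\<close>, then \<open>h k\<close>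
  differs from \<open>h z\<close> times \<open>k\<close> by at most \<open>\<epsilon> \<nu> k\<close>. Hence
  \<open>\<bar>h z\<bar> \<nu> k \<le> \<nu> (h k) + \<epsilon> \<nu> k \<le> (\<nu> h + \<epsilon>) \<nu> k\<close>, and \<open>\<nu> k > 0\<close> can be cancelled, however small it
  is compared with the supremum norm of \<open>k\<close>.
\<close>

context
  fixes X :: "'x topology" and Y :: "'y topology" and \<nu> :: "('x \<times> 'y \<Rightarrow> complex) \<Rightarrow> real"
    and S :: "('x \<times> 'y) set"
  assumes norm: "cstar_norm (fun_alg (tensor_span (Cb X) (Cb Y)) S) \<nu>"
begin

interpretation T: function_star_algebra "tensor_span (Cb X) (Cb Y)"
  by (intro function_star_algebra_tensor_span Cb.function_star_algebra_axioms)

interpretation N: cstar_norm "fun_alg (tensor_span (Cb X) (Cb Y)) S" \<nu>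
  by (rule norm)

text \<open>
  An elementary tensor is the product of \<open>a \<otimes> 1\<close> and \<open>1 \<otimes> b\<close>, and \<open>\<nu>\<close> restricted to either factor is
  a C*-seminorm on an algebra of all bounded continuous functions.
\<close>

lemma cstar_norm_tensor_fun_le:
  assumes a: "a \<in> Cb X" and b: "b \<in> Cb Y"
  shows "\<nu> (tensor_fun a b) \<le> sup_norm a * sup_norm b"
proof -
  let ?eX = "indicator (topspace X) :: 'x \<Rightarrow> complex" and ?eY = "indicator (topspace Y) :: 'y \<Rightarrow> complex"
  note [intro] = indicator_topspace_mem_Cb tensor_fun_mem_span
  have left: "\<nu> (tensor_fun a ?eY) \<le> sup_norm a"
  proof (rule cstar_seminorm_le_sup_norm[OF _ _ _ _ a])
    fix f g :: "'x \<Rightarrow> complex" assume f: "f \<in> Cb X"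
    then have f': "tensor_fun f ?eY \<in> tensor_span (Cb X) (Cb Y)" by blast
    show "0 \<le> \<nu> (tensor_fun f ?eY)"
      using N.norm_nonneg[of "tensor_fun f ?eY"] f' by simp
    show "\<nu> (tensor_fun (\<lambda>x. c * f x) ?eY) = cmod c * \<nu> (tensor_fun f ?eY)" for c
      using N.norm_smult[of "tensor_fun f ?eY" c] f' by (simp add: tensor_fun_def mult.assoc)
    have "(\<lambda>z. cnj (tensor_fun f ?eY z) * tensor_fun f ?eY z) = tensor_fun (\<lambda>x. cnj (f x) * f x) ?eY"
      by (auto simp: tensor_fun_def indicator_def)
    then show "\<nu> (tensor_fun (\<lambda>x. cnj (f x) * f x) ?eY) = (\<nu> (tensor_fun f ?eY))\<^sup>2"
      using N.norm_star_mult[of "tensor_fun f ?eY"] f' by simp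
    assume g: "g \<in> Cb X"
    then have "tensor_fun g ?eY \<in> tensor_span (Cb X) (Cb Y)" by blast
    then show "\<nu> (tensor_fun (\<lambda>x. f x + g x) ?eY) \<le> \<nu> (tensor_fun f ?eY) + \<nu> (tensor_fun g ?eY)"
      using N.norm_triangle[of "tensor_fun f ?eY" "tensor_fun g ?eY"] f'
      by (simp add: tensor_fun_def distrib_right)
  qed
  have right: "\<nu> (tensor_fun ?eX b) \<le> sup_norm b"
  proof (rule cstar_seminorm_le_sup_norm[OF _ _ _ _ b])
    fix f g :: "'y \<Rightarrow> complex" assume f: "f \<in> Cb Y"
    then have f': "tensor_fun ?eX f \<in> tensor_span (Cb X) (Cb Y)" by blast
    show "0 \<le> \<nu> (tensor_fun ?eX f)"
      using N.norm_nonneg[of "tensor_fun ?eX f"] f' by simp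
    show "\<nu> (tensor_fun ?eX (\<lambda>y. c * f y)) = cmod c * \<nu> (tensor_fun ?eX f)" for c
      using N.norm_smult[of "tensor_fun ?eX f" c] f' by (simp add: tensor_fun_def mult.left_commute)
    have "(\<lambda>z. cnj (tensor_fun ?eX f z) * tensor_fun ?eX f z) = tensor_fun ?eX (\<lambda>y. cnj (f y) * f y)"
      by (auto simp: tensor_fun_def indicator_def)
    then show "\<nu> (tensor_fun ?eX (\<lambda>y. cnj (f y) * f y)) = (\<nu> (tensor_fun ?eX f))\<^sup>2"
      using N.norm_star_mult[of "tensor_fun ?eX f"] f' by simp
    assume g: "g \<in> Cb Y"
    then have "tensor_fun ?eX g \<in> tensor_span (Cb X) (Cb Y)" by blast
    then show "\<nu> (tensor_fun ?eX (\<lambda>y. f y + g y)) \<le> \<nu> (tensor_fun ?eX f) + \<nu> (tensor_fun ?eX g)"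
      using N.norm_triangle[of "tensor_fun ?eX f" "tensor_fun ?eX g"] f'
      by (simp add: tensor_fun_def distrib_left)
  qed
  have "a x = 0" if "x \<notin> topspace X" for x using a that by (simp add: Cb_def)
  moreover have "b y = 0" if "y \<notin> topspace Y" for y using b that by (simp add: Cb_def)
  ultimately have "tensor_fun a b = (\<lambda>z. tensor_fun a ?eY z * tensor_fun ?eX b z)"
    by (auto simp: tensor_fun_def indicator_def fun_eq_iff)
  then have "\<nu> (tensor_fun a b) \<le> \<nu> (tensor_fun a ?eY) * \<nu> (tensor_fun ?eX b)"
    using N.norm_mult[of "tensor_fun a ?eY" "tensor_fun ?eX b"] a b by auto
  also have "\<dots> \<le> sup_norm a * sup_norm b"
    using left right a b N.norm_nonneg[of "tensor_fun ?eX b"]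
    by (intro mult_mono sup_norm_nonneg Cb.bounded_mem) auto
  finally show ?thesis .
qed

text \<open>
  The error is relative to a cutoff \<open>c \<otimes> d\<close> and not to a function \<open>k\<close> of unknown \<open>\<nu>\<close>-size; the estimate
  relative to \<open>k\<close> then follows by multiplying with a \<open>k\<close> that the cutoff fixes. For one elementary
  tensor, \<open>(a \<otimes> b - a x * b y) (c \<otimes> d)\<close> is the sum of \<open>(a - a x) c \<otimes> b d\<close> and
  \<open>(a x) c \<otimes> (b - b y) d\<close>, in each of which one factor is small in supremum norm when \<open>c\<close> and \<open>d\<close> live
  close to \<open>x\<close> and \<open>y\<close>.
\<close>

lemma cstar_norm_frozen_le:
  assumes "h \<in> tensor_span (Cb X) (Cb Y)" "x \<in> topspace X" "y \<in> topspace Y" "0 < e"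
  shows "\<exists>U V. openin X U \<and> x \<in> U \<and> openin Y V \<and> y \<in> V \<and>
    (\<forall>c\<in>Cb X. \<forall>d\<in>Cb Y. (\<forall>s. cmod (c s) \<le> 1) \<and> (\<forall>s. s \<notin> U \<longrightarrow> c s = 0) \<and>
      (\<forall>s. cmod (d s) \<le> 1) \<and> (\<forall>s. s \<notin> V \<longrightarrow> d s = 0) \<longrightarrow>
      \<nu> (\<lambda>z. (h z - h (x, y)) * tensor_fun c d z) \<le> e)"
  using assms
proof (induction arbitrary: e rule: tensor_span.induct)
  case zero
  then show ?case
    using N.norm_eq_zero[of "\<lambda>z. 0"] T.zero_mem
    by (intro exI[of _ "topspace X"] exI[of _ "topspace Y"]) auto
next
  case (add a b h)
  obtain U2 V2 where U2: "openin X U2" "x \<in> U2" and V2: "openin Y V2" "y \<in> V2"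
    and small: "\<And>c d. \<lbrakk>c \<in> Cb X; d \<in> Cb Y; \<forall>s. cmod (c s) \<le> 1; \<forall>s. s \<notin> U2 \<longrightarrow> c s = 0;
      \<forall>s. cmod (d s) \<le> 1; \<forall>s. s \<notin> V2 \<longrightarrow> d s = 0\<rbrakk>
      \<Longrightarrow> \<nu> (\<lambda>z. (h z - h (x, y)) * tensor_fun c d z) \<le> e / 2"
    using add.IH[OF add.prems(1,2), of "e / 2"] add.prems(3) by (auto simp: half_gt_zero)
  let ?A = "sup_norm a" and ?B = "sup_norm b"
  have A: "0 \<le> ?A" "\<And>s. cmod (a s) \<le> ?A" and B: "0 \<le> ?B" "\<And>s. cmod (b s) \<le> ?B"
    using add.hyps(1,2) by (auto intro!: sup_norm_nonneg norm_le_sup_norm Cb.bounded_mem)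
  \<comment> \<open>Half of \<open>e\<close> is left for \<open>h\<close> and a quarter for each elementary tensor; the summand \<open>1\<close> guards against zero norms.\<close>
  define \<alpha> where "\<alpha> = e / (4 * (?B + 1))"
  define \<beta> where "\<beta> = e / (4 * (?A + 1))"
  have \<alpha>: "0 < \<alpha>" "\<alpha> * ?B \<le> e / 4" and \<beta>: "0 < \<beta>" "?A * \<beta> \<le> e / 4"
    using A B add.prems(3) by (auto simp: \<alpha>_def \<beta>_def field_simps)
  define U1 where "U1 = {s \<in> topspace X. a s \<in> ball (a x) \<alpha>}"
  define V1 where "V1 = {s \<in> topspace Y. b s \<in> ball (b y) \<beta>}"
  have U1: "openin X U1" "x \<in> U1" and V1: "openin Y V1" "y \<in> V1"
    using add.hyps(1,2) add.prems(1,2) \<alpha>(1) \<beta>(1) unfolding U1_def V1_def Cb_def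
    by (auto intro!: openin_continuous_map_preimage simp del: mem_ball)
  have "\<nu> (\<lambda>z. (tensor_fun a b z + h z - (tensor_fun a b (x, y) + h (x, y))) * tensor_fun c d z) \<le> e"
    if c: "c \<in> Cb X" "\<forall>s. cmod (c s) \<le> 1" "\<forall>s. s \<notin> U1 \<inter> U2 \<longrightarrow> c s = 0"
      and d: "d \<in> Cb Y" "\<forall>s. cmod (d s) \<le> 1" "\<forall>s. s \<notin> V1 \<inter> V2 \<longrightarrow> d s = 0" for c d
  proof -
    let ?ca = "\<lambda>s. a s * c s - a x * c s" and ?db = "\<lambda>s. b s * d s - b y * d s"
    let ?bd = "\<lambda>s. b s * d s" and ?cx = "\<lambda>s. a x * c s"
    let ?r = "\<lambda>z. (h z - h (x, y)) * tensor_fun c d z"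
    have cx: "?cx \<in> Cb X" and by_d: "(\<lambda>s. b y * d s) \<in> Cb Y" and bd: "?bd \<in> Cb Y"
      using Cb.smult_mem[OF c(1)] Cb.smult_mem[OF d(1)] Cb.mult_mem[OF add.hyps(2) d(1)] by auto
    note mem = Cb.diff_mem[OF Cb.mult_mem[OF add.hyps(1) c(1)] cx]
      Cb.diff_mem[OF bd by_d] bd cx
    have r: "?r \<in> tensor_span (Cb X) (Cb Y)"
    proof -
      have "(\<lambda>z. h z * tensor_fun c d z + (- h (x, y)) * tensor_fun c d z) \<in> tensor_span (Cb X) (Cb Y)"
        using add.hyps(3) c(1) d(1)
        by (intro T.add_mem T.mult_mem T.smult_mem tensor_fun_mem_span) auto
      then show ?thesis by (simp add: algebra_simps)
    qed
    have "cmod (?ca s) \<le> \<alpha>" for s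
    proof (cases "s \<in> U1")
      case True
      then have "cmod (a s - a x) * cmod (c s) \<le> \<alpha> * 1"
        using c(2) \<alpha>(1) unfolding U1_def
        by (intro mult_mono) (auto simp: dist_norm norm_minus_commute less_imp_le)
      then show ?thesis by (simp flip: norm_mult add: algebra_simps)
    qed (use c(3) \<alpha>(1) in auto)
    then have 1: "sup_norm ?ca \<le> \<alpha>" by (rule sup_norm_le)
    have "cmod (?db s) \<le> \<beta>" for s
    proof (cases "s \<in> V1")
      case True
      then have "cmod (b s - b y) * cmod (d s) \<le> \<beta> * 1"
        using d(2) \<beta>(1) unfolding V1_def
        by (intro mult_mono) (auto simp: dist_norm norm_minus_commute less_imp_le)
      then show ?thesis by (simp flip: norm_mult add: algebra_simps)
    qed (use d(3) \<beta>(1) in auto)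
    then have 2: "sup_norm ?db \<le> \<beta>" by (rule sup_norm_le)
    have "cmod (?bd s) \<le> ?B * 1" for s
      unfolding norm_mult using B d(2) by (intro mult_mono) auto
    then have 3: "sup_norm ?bd \<le> ?B" by (intro sup_norm_le) simp
    have "cmod (?cx s) \<le> ?A * 1" for s
      unfolding norm_mult using A c(2) by (intro mult_mono) auto
    then have 4: "sup_norm ?cx \<le> ?A" by (intro sup_norm_le) simp
    have "\<nu> (tensor_fun ?ca ?bd) \<le> sup_norm ?ca * sup_norm ?bd"
      by (rule cstar_norm_tensor_fun_le[OF mem(1,3)])
    also have "\<dots> \<le> \<alpha> * ?B"
      by (rule mult_mono[OF 1 3 less_imp_le[OF \<alpha>(1)] sup_norm_nonneg[OF Cb.bounded_mem[OF mem(3)]]])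
    finally have t1: "\<nu> (tensor_fun ?ca ?bd) \<le> e / 4" using \<alpha>(2) by linarith
    have "\<nu> (tensor_fun ?cx ?db) \<le> sup_norm ?cx * sup_norm ?db"
      by (rule cstar_norm_tensor_fun_le[OF mem(4,2)])
    also have "\<dots> \<le> ?A * \<beta>"
      by (rule mult_mono[OF 4 2 A(1) sup_norm_nonneg[OF Cb.bounded_mem[OF mem(2)]]])
    finally have t2: "\<nu> (tensor_fun ?cx ?db) \<le> e / 4" using \<beta>(2) by linarith
    have t3: "\<nu> ?r \<le> e / 2" using c d by (intro small) auto
    have split: "(\<lambda>z. (tensor_fun a b z + h z - (tensor_fun a b (x, y) + h (x, y))) * tensor_fun c d z)
      = (\<lambda>z. tensor_fun ?ca ?bd z + (tensor_fun ?cx ?db z + ?r z))"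
      by (auto simp: tensor_fun_def algebra_simps)
    have "\<nu> (\<lambda>z. tensor_fun ?ca ?bd z + (tensor_fun ?cx ?db z + ?r z))
        \<le> \<nu> (tensor_fun ?ca ?bd) + (\<nu> (tensor_fun ?cx ?db) + \<nu> ?r)"
      using N.norm_triangle[of "tensor_fun ?ca ?bd" "\<lambda>z. tensor_fun ?cx ?db z + ?r z"]
        N.norm_triangle[of "tensor_fun ?cx ?db" ?r]
        tensor_fun_mem_span[OF mem(1,3)] tensor_fun_mem_span[OF mem(4,2)] r
        T.add_mem[OF tensor_fun_mem_span[OF mem(4,2)] r] by simp
    then show ?thesis unfolding split using t1 t2 t3 by linarith
  qed
  then show ?case
    using U1 U2 V1 V2 by (intro exI[of _ "U1 \<inter> U2"] exI[of _ "V1 \<inter> V2"]) blast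
qed

lemma sup_norm_le_cstar_norm:
  assumes X: "completely_regular_space X" and Y: "completely_regular_space Y"
    and h: "h \<in> tensor_span (Cb X) (Cb Y)"
  shows "sup_norm h \<le> \<nu> h"
proof (rule sup_norm_le)
  fix z :: "'x \<times> 'y"
  obtain x y where z: "z = (x, y)" by fastforce
  have h0: "0 \<le> \<nu> h" using N.norm_nonneg[of h] h by simp
  show "cmod (h z) \<le> \<nu> h"
  proof (cases "x \<in> topspace X \<and> y \<in> topspace Y")
    case False
    have "h z = 0"
      using h False unfolding z
      by (induction rule: tensor_span.induct) (auto simp: tensor_fun_def Cb_def)
    then show ?thesis using h0 by simp
  next
    case True
    show ?thesis
    proof (rule field_le_epsilon)
      fix e :: real assume "0 < e"
      then obtain U V where UV: "openin X U" "x \<in> U" "openin Y V" "y \<in> V"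
        and small: "\<forall>c\<in>Cb X. \<forall>d\<in>Cb Y. (\<forall>s. cmod (c s) \<le> 1) \<and> (\<forall>s. s \<notin> U \<longrightarrow> c s = 0) \<and>
          (\<forall>s. cmod (d s) \<le> 1) \<and> (\<forall>s. s \<notin> V \<longrightarrow> d s = 0) \<longrightarrow>
          \<nu> (\<lambda>z. (h z - h (x, y)) * tensor_fun c d z) \<le> e"
        using cstar_norm_frozen_le[OF h, of x y e] True by blast
      obtain c f where cf: "c \<in> Cb X" "f \<in> Cb X" "\<And>s. cmod (c s) \<le> 1" "\<And>s. s \<notin> U \<Longrightarrow> c s = 0"
        "\<And>s. c s * f s = f s" "f x = 1"
        using bump_functions[OF X UV(1,2)] by blast
      obtain d g where dg: "d \<in> Cb Y" "g \<in> Cb Y" "\<And>s. cmod (d s) \<le> 1" "\<And>s. s \<notin> V \<Longrightarrow> d s = 0"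
        "\<And>s. d s * g s = g s" "g y = 1"
        using bump_functions[OF Y UV(3,4)] by blast
      let ?k = "tensor_fun f g" and ?r = "\<lambda>z. (h z - h (x, y)) * tensor_fun c d z"
      have k: "?k \<in> tensor_span (Cb X) (Cb Y)" and cd: "tensor_fun c d \<in> tensor_span (Cb X) (Cb Y)"
        using cf dg by (auto intro: tensor_fun_mem_span)
      have r: "?r \<in> tensor_span (Cb X) (Cb Y)"
        using T.diff_mem[OF T.mult_mem[OF h cd] T.smult_mem[OF cd, of "h (x, y)"]]
        by (simp add: left_diff_distrib)
      have "?k (x, y) = 1" using cf dg by (simp add: tensor_fun_def)
      then have "?k \<noteq> (\<lambda>z. 0)" by (metis zero_neq_one)
      then have pos: "0 < \<nu> ?k"
        using N.norm_nonneg[of ?k] N.norm_eq_zero[of ?k] k by simp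
      have absorb: "tensor_fun c d w * ?k w = ?k w" for w
      proof -
        have "tensor_fun c d w * ?k w = (c (fst w) * f (fst w)) * (d (snd w) * g (snd w))"
          by (simp add: tensor_fun_def)
        then show ?thesis by (simp only: cf(5) dg(5)) (simp add: tensor_fun_def)
      qed
      \<comment> \<open>The difference is a sum with a scalar multiple, so that the triangle inequality and homogeneity of \<open>\<nu>\<close> apply.\<close>
      have eq: "(\<lambda>w. h (x, y) * ?k w) = (\<lambda>w. h w * ?k w + (- 1) * (?r w * ?k w))"
        by (simp only: mult.assoc absorb) (simp add: algebra_simps)
      have "cmod (h z) * \<nu> ?k = \<nu> (\<lambda>w. h (x, y) * ?k w)"
        using N.norm_smult[of ?k "h (x, y)"] k by (simp add: z)
      also have "\<dots> \<le> \<nu> (\<lambda>w. h w * ?k w) + \<nu> (\<lambda>w. (- 1) * (?r w * ?k w))"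
        unfolding eq using N.norm_triangle[of "\<lambda>w. h w * ?k w" "\<lambda>w. (- 1) * (?r w * ?k w)"]
          T.mult_mem[OF h k] T.smult_mem[OF T.mult_mem[OF r k], of "-1"] by simp
      also have "\<nu> (\<lambda>w. (- 1) * (?r w * ?k w)) = \<nu> (\<lambda>w. ?r w * ?k w)"
        using N.norm_smult[of "\<lambda>w. ?r w * ?k w" "-1"] T.mult_mem[OF r k] by simp
      also have "\<nu> (\<lambda>w. h w * ?k w) + \<nu> (\<lambda>w. ?r w * ?k w) \<le> \<nu> h * \<nu> ?k + \<nu> ?r * \<nu> ?k"
        using N.norm_mult[of h ?k] N.norm_mult[of ?r ?k] h r k by simp
      also have "\<dots> \<le> (\<nu> h + e) * \<nu> ?k"
        using small cf(1,3,4) dg(1,3,4) pos by (simp add: distrib_right)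
      finally show "cmod (h z) \<le> \<nu> h + e" using pos by simp
    qed
  qed
qed

end

abbreviation Cb_tensor :: "'x topology \<Rightarrow> 'y topology \<Rightarrow> ('x \<times> 'y \<Rightarrow> complex) cstar_alg"
  where "Cb_tensor X Y \<equiv>
    fun_alg (uniform_closure (tensor_span (Cb X) (Cb Y))) (topspace X \<times> topspace Y)"

abbreviation Cb_alg :: "'x topology \<Rightarrow> ('x \<Rightarrow> complex) cstar_alg"
  where "Cb_alg X \<equiv> fun_alg (Cb X) (topspace X)"

text \<open>
  Density holds by construction of the closure. The closure itself may be smaller than the algebra
  of all bounded continuous functions on \<open>X \<times> Y\<close>.
\<close>

theorem min_cstar_tensor_product_Cb:
  assumes X: "completely_regular_space X" and Y: "completely_regular_space Y"
  shows "min_cstar_tensor_product (Cb_alg X) (Cb_alg Y) (Cb_tensor X Y) tensor_fun"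
proof -
  let ?T = "tensor_span (Cb X) (Cb Y)"
  interpret T: function_star_algebra ?T
    by (intro function_star_algebra_tensor_span Cb.function_star_algebra_axioms)
  interpret C: uniform_algebra "uniform_closure ?T"
    by (rule T.uniform_algebra_uniform_closure)
  have image: "tensor_lift (Cb_tensor X Y) tensor_fun ` formal_sums (Cb_alg X) (Cb_alg Y) = ?T"
    by (intro tensor_lift_image Cb.function_star_algebra_axioms C.function_star_algebra_axioms
        subset_uniform_closure)
  have tensor: "cstar_tensor_product (Cb_alg X) (Cb_alg Y) (Cb_tensor X Y) tensor_fun"
  proof (intro cstar_tensor_product.intro cstar_tensor_product_axioms.intro
      Cb.cstar_algebra_fun_alg C.cstar_algebra_fun_alg)
    show "norm_topology (Cb_tensor X Y) closure_of
        (tensor_lift (Cb_tensor X Y) tensor_fun ` formal_sums (Cb_alg X) (Cb_alg Y)) = carrier (Cb_tensor X Y)"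
      unfolding image C.closure_of_fun_alg[OF subset_uniform_closure]
      by (auto simp: uniform_closure_def)
    show "u \<in> tensor_relations (Cb_alg X) (Cb_alg Y)"
      if "u \<in> formal_sums (Cb_alg X) (Cb_alg Y)" "tensor_lift (Cb_tensor X Y) tensor_fun u = \<zero>\<^bsub>Cb_tensor X Y\<^esub>" for u
      using that by (intro tensor_lift_injective[OF Cb.function_star_algebra_axioms
            Cb.function_star_algebra_axioms C.function_star_algebra_axioms subset_uniform_closure]) auto
    show "tensor_fun a b \<in> carrier (Cb_tensor X Y)" if "a \<in> carrier (Cb_alg X)" "b \<in> carrier (Cb_alg Y)" for a b
      using that tensor_fun_mem_span subset_uniform_closure by fastforce
  qed (auto simp: tensor_fun_def algebra_simps)
  show ?thesis
  proof (intro min_cstar_tensor_product.intro tensor min_cstar_tensor_product_axioms.intro)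
    fix \<nu> h
    assume "cstar_norm (cstar_tensor_product.algebraic_part (Cb_alg X) (Cb_alg Y) (Cb_tensor X Y) tensor_fun) \<nu>"
      and "h \<in> carrier (cstar_tensor_product.algebraic_part (Cb_alg X) (Cb_alg Y) (Cb_tensor X Y) tensor_fun)"
    then have "cstar_norm (fun_alg ?T (topspace X \<times> topspace Y)) \<nu>" "h \<in> ?T"
      by (simp_all add: cstar_tensor_product.algebraic_part_def[OF tensor] image)
    then show "cnorm (Cb_tensor X Y) h \<le> \<nu> h"
      using sup_norm_le_cstar_norm[OF _ X Y] by simp
  qed
qed


section \<open>The countable chain condition\<close>

text \<open>
  A function with \<open>f x \<noteq> 0\<close> has distance at least \<open>\<bar>f x\<bar>\<close> from all functions vanishing at \<open>x\<close>.
\<close>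

lemma (in function_star_algebra) closed_ideal_vanishing:
  "closed_ideal (fun_alg D S) {f \<in> D. \<forall>x\<in>Z. f x = 0}" (is "closed_ideal _ ?I")
proof -
  interpret M: Metric_space D "cdist (fun_alg D S)" by (rule Metric_space_fun_alg)
  interpret star_algebra "fun_alg D S" by (rule star_algebra_fun_alg)
  have "submodule ?I complex_field (fun_alg D S)"
  proof (rule submoduleI)
    fix f assume f: "f \<in> ?I"
    then have "\<ominus>\<^bsub>fun_alg D S\<^esub> f = (\<lambda>x. - f x)"
      by (intro minus_equality) (auto simp: uminus_mem)
    then show "\<ominus>\<^bsub>fun_alg D S\<^esub> f \<in> ?I" using f by (auto simp: uminus_mem)
  qed (auto simp: zero_mem add_mem smult_mem)
  moreover have "closedin (norm_topology (fun_alg D S)) ?I"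
    unfolding norm_topology_def fun_alg_simps M.closedin_metric
  proof (intro conjI allI impI)
    fix f assume "f \<in> D - ?I"
    then obtain x where f: "f \<in> D" and x: "x \<in> Z" "f x \<noteq> 0" by auto
    have "\<not> cdist (fun_alg D S) f g < cmod (f x)" if "g \<in> ?I" for g
      using norm_le_sup_norm[OF bounded_mem[OF diff_mem[of f g]], of x] that f x
      by (simp add: cdist_fun_alg)
    then show "\<exists>r>0. disjnt ?I (M.mball f r)"
      using x by (intro exI[of _ "cmod (f x)"]) (auto simp: disjnt_iff)
  qed auto
  ultimately show ?thesis
    by (auto simp: closed_ideal_def mult_mem)
qed

lemma topological_CCC_countable_index:
  assumes CCC: "topological_CCC X"
    and U: "\<And>i. i \<in> I \<Longrightarrow> openin X (U i)" "\<And>i. i \<in> I \<Longrightarrow> U i \<noteq> {}"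
    and disj: "\<And>i j. \<lbrakk>i \<in> I; j \<in> I; i \<noteq> j\<rbrakk> \<Longrightarrow> U i \<inter> U j = {}"
  shows "countable I"
proof -
  have "\<forall>V\<in>U ` I. openin X V \<and> V \<noteq> {}" using U by simp
  moreover have "pairwise disjnt (U ` I)"
    using disj by (intro pairwiseI) (auto simp: disjnt_def)
  ultimately have "countable (U ` I)"
    using CCC unfolding topological_CCC_def by simp
  moreover have "inj_on U I"
  proof (rule inj_onI)
    fix i j assume ij: "i \<in> I" "j \<in> I" "U i = U j"
    then show "i = j" using disj[of i j] U(2)[of i] by auto
  qed
  ultimately show ?thesis by (rule countable_image_inj_on)
qed

text \<open>
  A nonzero element of each ideal has a nonempty open set of nonzeros. The product of the elements
  chosen from two orthogonal ideals lies in both, so it is zero and the open sets are disjoint.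
\<close>

theorem cstar_CCC_Cb:
  assumes "topological_CCC X"
  shows "cstar_CCC (fun_alg (Cb X) S)"
  unfolding cstar_CCC_def
proof (intro allI impI, elim conjE)
  fix \<I>
  assume ideals: "\<forall>I\<in>\<I>. closed_ideal (fun_alg (Cb X) S) I \<and> I \<noteq> {\<zero>\<^bsub>fun_alg (Cb X) S\<^esub>}"
    and orth: "pairwise (\<lambda>I J. I \<inter> J = {\<zero>\<^bsub>fun_alg (Cb X) S\<^esub>}) \<I>"
  interpret star_algebra "fun_alg (Cb X) S" by (rule Cb.star_algebra_fun_alg)
  have "\<exists>f\<in>I. f \<noteq> (\<lambda>x. 0) \<and> f \<in> Cb X" if "I \<in> \<I>" for I
  proof -
    have "submodule I complex_field (fun_alg (Cb X) S)"
      using ideals that by (auto simp: closed_ideal_def)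
    then have "subgroup I (add_monoid (fun_alg (Cb X) S))"
      by (rule submodule.axioms(1))
    then have sub: "(\<lambda>x. 0) \<in> I" "I \<subseteq> Cb X"
      using subgroup.one_closed[of I "add_monoid (fun_alg (Cb X) S)"]
        subgroup.subset[of I "add_monoid (fun_alg (Cb X) S)"] by simp_all
    moreover have "I \<noteq> {\<lambda>x. 0}" using ideals that by simp
    ultimately show ?thesis by auto
  qed
  then obtain f where f: "\<And>I. I \<in> \<I> \<Longrightarrow> f I \<in> I" "\<And>I. I \<in> \<I> \<Longrightarrow> f I \<noteq> (\<lambda>x. 0)"
    "\<And>I. I \<in> \<I> \<Longrightarrow> f I \<in> Cb X" by metis
  define U where "U I = {x \<in> topspace X. f I x \<in> - {0}}" for I
  have U: "openin X (U I)" "U I \<noteq> {}" if "I \<in> \<I>" for I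
  proof -
    show "openin X (U I)"
      using f(3)[OF that] unfolding U_def Cb_def by (auto intro!: openin_continuous_map_preimage simp del: Compl_iff)
    show "U I \<noteq> {}"
      using f(2,3)[OF that] unfolding U_def Cb_def by (auto simp: fun_eq_iff)
  qed
  have disj: "U I \<inter> U J = {}" if "I \<in> \<I>" "J \<in> \<I>" "I \<noteq> J" for I J
  proof -
    have "(\<lambda>x. f I x * f J x) \<in> I \<inter> J"
      using ideals f that by (force simp: closed_ideal_def)
    then have "(\<lambda>x. f I x * f J x) = (\<lambda>x. 0)"
      using orth that by (auto simp: pairwise_def)
    then show ?thesis by (auto simp: U_def fun_eq_iff)
  qed
  show "countable \<I>"
    by (rule topological_CCC_countable_index[OF assms U disj])
qed

text \<open>
  An open set \<open>W\<close> of the product gives the ideal of functions vanishing off \<open>W\<close>. It is nonzero since it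
  contains the elementary tensor of two bumps supported in a box inside \<open>W\<close>.
\<close>

theorem not_cstar_CCC_Cb_tensor:
  assumes X: "completely_regular_space X" and Y: "completely_regular_space Y"
    and "\<not> topological_CCC (prod_topology X Y)"
  shows "\<not> cstar_CCC (Cb_tensor X Y)"
proof -
  let ?T = "tensor_span (Cb X) (Cb Y)"
  let ?D = "uniform_closure ?T"
  interpret T: function_star_algebra ?T
    by (intro function_star_algebra_tensor_span Cb.function_star_algebra_axioms)
  interpret C: uniform_algebra ?D
    by (rule T.uniform_algebra_uniform_closure)
  obtain \<W> where \<W>: "\<forall>W\<in>\<W>. openin (prod_topology X Y) W \<and> W \<noteq> {}" "pairwise disjnt \<W>"
    "uncountable \<W>"
    using assms(3) unfolding topological_CCC_def by blast
  define I where "I W = {h \<in> ?D. \<forall>z\<in>-W. h z = 0}" for W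
  have nonzero: "\<exists>h\<in>I W. h \<noteq> (\<lambda>z. 0)" if "W \<in> \<W>" for W
  proof -
    have W: "openin (prod_topology X Y) W" "W \<noteq> {}" using \<W>(1) that by auto
    then obtain x y where xy: "(x, y) \<in> W" by auto
    have "\<exists>U V. openin X U \<and> openin Y V \<and> x \<in> U \<and> y \<in> V \<and> U \<times> V \<subseteq> W"
      using W(1)[unfolded openin_prod_topology_alt, rule_format, OF xy] .
    then obtain U V where UV: "openin X U" "openin Y V" "x \<in> U" "y \<in> V" "U \<times> V \<subseteq> W"
      by (elim exE conjE) (rule that)
    obtain f c where f: "f \<in> Cb X" "f x = 1" "\<And>s. s \<notin> U \<Longrightarrow> c s = 0" "\<And>s. c s * f s = f s"
      by (rule bump_functions[OF X UV(1,3)]) (rule that)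
    obtain g d where g: "g \<in> Cb Y" "g y = 1" "\<And>s. s \<notin> V \<Longrightarrow> d s = 0" "\<And>s. d s * g s = g s"
      by (rule bump_functions[OF Y UV(2,4)]) (rule that)
    have "f s = 0" if "s \<notin> U" for s using f(3)[OF that] f(4)[of s] by simp
    moreover have "g s = 0" if "s \<notin> V" for s using g(3)[OF that] g(4)[of s] by simp
    ultimately have "tensor_fun f g z = 0" if "z \<notin> W" for z
      using that UV(5) by (cases z) (auto simp: tensor_fun_def)
    moreover have "tensor_fun f g \<in> ?D"
      using tensor_fun_mem_span[OF f(1) g(1)] subset_uniform_closure by blast
    moreover have "tensor_fun f g (x, y) = 1" using f g by (simp add: tensor_fun_def)
    then have "tensor_fun f g \<noteq> (\<lambda>z. 0)" by (metis zero_neq_one)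
    ultimately show ?thesis by (auto simp: I_def)
  qed
  have orth: "I V \<inter> I W = {\<lambda>z. 0}" if "V \<in> \<W>" "W \<in> \<W>" "V \<noteq> W" for V W
  proof -
    have "V \<inter> W = {}"
      using pairwiseD[OF \<W>(2) that] by (simp add: disjnt_def)
    then have "z \<notin> V \<or> z \<notin> W" for z by blast
    then show ?thesis using C.zero_mem by (fastforce simp: I_def)
  qed
  have "inj_on I \<W>"
  proof (rule inj_onI)
    fix V W assume VW: "V \<in> \<W>" "W \<in> \<W>" "I V = I W"
    then show "V = W" using orth[of V W] nonzero[of V] by auto
  qed
  then have "uncountable (I ` \<W>)"
    using \<W>(3) countable_image_inj_on by blast
  moreover have "\<forall>J\<in>I ` \<W>. closed_ideal (Cb_tensor X Y) J \<and> J \<noteq> {\<zero>\<^bsub>Cb_tensor X Y\<^esub>}"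
    using nonzero unfolding I_def by (force intro: C.closed_ideal_vanishing)
  moreover have "pairwise (\<lambda>J K. J \<inter> K = {\<zero>\<^bsub>Cb_tensor X Y\<^esub>}) (I ` \<W>)"
    using orth by (auto simp: pairwise_def)
  ultimately show ?thesis unfolding cstar_CCC_def by blast
qed

section \<open>The lower limit topology of a Suslin line\<close>

definition half_open_interval :: "'s rel \<Rightarrow> 's \<Rightarrow> 's \<Rightarrow> 's set"
  where "half_open_interval r a b = {x. (a, x) \<in> r \<and> (x, b) \<in> r \<and> x \<noteq> b}"

text \<open>
  The topology of the Sorgenfrey line. Its half-open intervals are clopen, so complete regularity
  comes from indicator functions, while CCC passes to it from the order topology
  because every half-open interval contains a nonempty open one.
\<close>

definition lower_limit_topology :: "'s set \<Rightarrow> 's rel \<Rightarrow> 's topology"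
  where "lower_limit_topology S r = topology (\<lambda>U. U \<subseteq> S \<and>
    (\<forall>x\<in>U. \<exists>b\<in>S. (x, b) \<in> r \<and> x \<noteq> b \<and> half_open_interval r x b \<subseteq> U))"

context
  fixes S :: "'s set" and r :: "'s rel"
  assumes lin: "linear_order_on S r" and unb: "unbounded_order S r" and dense: "dense_order S r"
begin

lemma r_carrier: "(x, y) \<in> r \<Longrightarrow> x \<in> S \<and> y \<in> S"
  and r_refl: "x \<in> S \<Longrightarrow> (x, x) \<in> r"
  and r_trans: "\<lbrakk>(x, y) \<in> r; (y, z) \<in> r\<rbrakk> \<Longrightarrow> (x, z) \<in> r"
  and r_antisym: "\<lbrakk>(x, y) \<in> r; (y, x) \<in> r\<rbrakk> \<Longrightarrow> x = y"
  and r_total: "\<lbrakk>x \<in> S; y \<in> S\<rbrakk> \<Longrightarrow> (x, y) \<in> r \<or> (y, x) \<in> r"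
proof -
  have *: "r \<subseteq> S \<times> S" "refl_on S r" "trans r" "antisym r" "total_on S r"
    using lin by (auto simp: linear_order_on_def partial_order_on_def preorder_on_def)
  show "(x, y) \<in> r \<Longrightarrow> x \<in> S \<and> y \<in> S" using *(1) by auto
  show refl: "x \<in> S \<Longrightarrow> (x, x) \<in> r" for x using *(2) by (rule refl_onD)
  show "\<lbrakk>(x, y) \<in> r; (y, z) \<in> r\<rbrakk> \<Longrightarrow> (x, z) \<in> r" using *(3) by (rule transD)
  show "\<lbrakk>(x, y) \<in> r; (y, x) \<in> r\<rbrakk> \<Longrightarrow> x = y" using *(4) by (rule antisymD)
  show "\<lbrakk>x \<in> S; y \<in> S\<rbrakk> \<Longrightarrow> (x, y) \<in> r \<or> (y, x) \<in> r"
    using *(5) refl[of x] by (cases "x = y") (auto simp: total_on_def)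
qed

lemma exists_greater:
  assumes "x \<in> S"
  shows "\<exists>b\<in>S. (x, b) \<in> r \<and> x \<noteq> b"
proof -
  obtain b where "b \<in> S" "(b, x) \<notin> r"
    using unb assms unfolding unbounded_order_def by auto
  then show ?thesis using r_total[OF assms, of b] r_refl[OF assms] by auto
qed

lemma exists_less:
  assumes "x \<in> S"
  shows "\<exists>a\<in>S. (a, x) \<in> r \<and> a \<noteq> x"
proof -
  obtain a where "a \<in> S" "(x, a) \<notin> r"
    using unb assms unfolding unbounded_order_def by auto
  then show ?thesis using r_total[OF assms, of a] r_refl[OF assms] by auto
qed

lemma half_open_interval_mono:
  "\<lbrakk>(a, x) \<in> r; (y, b) \<in> r\<rbrakk> \<Longrightarrow> half_open_interval r x y \<subseteq> half_open_interval r a b"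
  unfolding half_open_interval_def using r_trans r_antisym by blast

lemma openin_lower_limit_topology:
  "openin (lower_limit_topology S r) U \<longleftrightarrow> U \<subseteq> S \<and>
    (\<forall>x\<in>U. \<exists>b\<in>S. (x, b) \<in> r \<and> x \<noteq> b \<and> half_open_interval r x b \<subseteq> U)"
proof -
  have "istopology (\<lambda>U. U \<subseteq> S \<and>
    (\<forall>x\<in>U. \<exists>b\<in>S. (x, b) \<in> r \<and> x \<noteq> b \<and> half_open_interval r x b \<subseteq> U))"
    unfolding istopology_def
  proof (intro conjI allI impI ballI; (elim conjE)?)
    fix U V x
    assume U: "\<forall>x\<in>U. \<exists>b\<in>S. (x, b) \<in> r \<and> x \<noteq> b \<and> half_open_interval r x b \<subseteq> U"
      and V: "\<forall>x\<in>V. \<exists>b\<in>S. (x, b) \<in> r \<and> x \<noteq> b \<and> half_open_interval r x b \<subseteq> V"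
      and x: "x \<in> U \<inter> V"
    obtain b where b: "b \<in> S" "(x, b) \<in> r" "x \<noteq> b" "half_open_interval r x b \<subseteq> U" using U x by blast
    obtain c where c: "c \<in> S" "(x, c) \<in> r" "x \<noteq> c" "half_open_interval r x c \<subseteq> V" using V x by blast
    have xx: "(x, x) \<in> r" using r_refl r_carrier b(2) by blast
    show "\<exists>b\<in>S. (x, b) \<in> r \<and> x \<noteq> b \<and> half_open_interval r x b \<subseteq> U \<inter> V"
    proof (cases "(b, c) \<in> r")
      case True
      then show ?thesis using b c half_open_interval_mono[OF xx True] by blast
    next
      case False
      then have "(c, b) \<in> r" using r_total b c by blast
      then show ?thesis using b c half_open_interval_mono[OF xx] by blast
    qed
  next
    fix \<K> x
    assume K: "\<forall>U\<in>\<K>. U \<subseteq> S \<and> (\<forall>x\<in>U. \<exists>b\<in>S. (x, b) \<in> r \<and> x \<noteq> b \<and> half_open_interval r x b \<subseteq> U)"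
      and x: "x \<in> \<Union> \<K>"
    then obtain U where U: "U \<in> \<K>" "x \<in> U" by blast
    then obtain b where "b \<in> S" "(x, b) \<in> r" "x \<noteq> b" "half_open_interval r x b \<subseteq> U" using K by blast
    then show "\<exists>b\<in>S. (x, b) \<in> r \<and> x \<noteq> b \<and> half_open_interval r x b \<subseteq> \<Union> \<K>"
      using U(1) by blast
  qed blast+
  then show ?thesis unfolding lower_limit_topology_def by simp
qed

lemma topspace_lower_limit_topology [simp]: "topspace (lower_limit_topology S r) = S"
proof -
  have "half_open_interval r x b \<subseteq> S" for x b
    using r_carrier unfolding half_open_interval_def by blast
  then have "openin (lower_limit_topology S r) S"
    using exists_greater unfolding openin_lower_limit_topology by blast
  moreover have "topspace (lower_limit_topology S r) \<subseteq> S"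
    using openin_topspace[of "lower_limit_topology S r"] unfolding openin_lower_limit_topology by blast
  ultimately show ?thesis using openin_subset by blast
qed

lemma openin_half_open_interval: "openin (lower_limit_topology S r) (half_open_interval r a b)"
  unfolding openin_lower_limit_topology
proof (intro conjI ballI)
  show "half_open_interval r a b \<subseteq> S"
    using r_carrier unfolding half_open_interval_def by blast
  fix x assume "x \<in> half_open_interval r a b"
  then have x: "(a, x) \<in> r" "(x, b) \<in> r" "x \<noteq> b" unfolding half_open_interval_def by auto
  then show "\<exists>c\<in>S. (x, c) \<in> r \<and> x \<noteq> c \<and> half_open_interval r x c \<subseteq> half_open_interval r a b"
    using half_open_interval_mono[of a x b b] r_refl[of b] r_carrier[of x b] by blast
qed

text \<open>
  Points below \<open>a\<close> are separated from the interval by \<open>[x, a)\<close>; for points from \<open>b\<close> on, any interval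
  starting at \<open>x\<close> works, and one exists because the order has no maximum.
\<close>

lemma closedin_half_open_interval:
  assumes "a \<in> S" "b \<in> S"
  shows "closedin (lower_limit_topology S r) (half_open_interval r a b)"
  unfolding closedin_def
proof (intro conjI)
  show "half_open_interval r a b \<subseteq> topspace (lower_limit_topology S r)"
    using openin_half_open_interval by (rule openin_subset)
  show "openin (lower_limit_topology S r) (topspace (lower_limit_topology S r) - half_open_interval r a b)"
    unfolding openin_lower_limit_topology topspace_lower_limit_topology
  proof (intro conjI ballI)
    fix x assume x: "x \<in> S - half_open_interval r a b"
    have S: "half_open_interval r x c \<subseteq> S" for c
      using r_carrier unfolding half_open_interval_def by blast
    show "\<exists>c\<in>S. (x, c) \<in> r \<and> x \<noteq> c \<and> half_open_interval r x c \<subseteq> S - half_open_interval r a b"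
    proof (cases "(a, x) \<in> r")
      case False
      then have "(x, a) \<in> r" "x \<noteq> a" using x assms r_total r_refl by blast+
      moreover have "half_open_interval r x a \<inter> half_open_interval r a b = {}"
        unfolding half_open_interval_def using r_antisym by blast
      ultimately show ?thesis using assms S by blast
    next
      case True
      then have bx: "(b, x) \<in> r"
        using x assms r_total[of b x] r_refl unfolding half_open_interval_def by blast
      obtain c where c: "c \<in> S" "(x, c) \<in> r" "x \<noteq> c" using exists_greater x by blast
      have "half_open_interval r x c \<inter> half_open_interval r a b = {}"
        unfolding half_open_interval_def using bx r_antisym r_trans by blast
      then show ?thesis using c S by blast
    qed
  qed blast
qed

lemma completely_regular_lower_limit_topology:
  "completely_regular_space (lower_limit_topology S r)" (is "completely_regular_space ?X")
  unfolding completely_regular_space_def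
proof (intro allI impI, elim conjE)
  fix C x assume C: "closedin ?X C" and x: "x \<in> topspace ?X - C"
  then obtain b where b: "b \<in> S" "(x, b) \<in> r" "x \<noteq> b" "half_open_interval r x b \<subseteq> S - C"
    unfolding closedin_def openin_lower_limit_topology[of "_ - _"] topspace_lower_limit_topology by blast
  let ?H = "half_open_interval r x b"
  let ?f = "\<lambda>y. if y \<in> ?H then 0 else 1 :: real"
  have xH: "x \<in> ?H" using b x r_refl unfolding half_open_interval_def by auto
  have HS: "openin ?X ?H" "openin ?X (topspace ?X - ?H)"
    using openin_half_open_interval closedin_half_open_interval[of x b] x b(1)
    unfolding closedin_def by auto
  have "continuous_map ?X (top_of_set {0..1}) ?f"
    unfolding continuous_map_in_subtopology
  proof
    show "continuous_map ?X euclideanreal ?f"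
      unfolding continuous_map_def
    proof (intro conjI allI impI)
      fix V :: "real set"
      have "{y \<in> topspace ?X. ?f y \<in> V} =
          (if 0 \<in> V then ?H else {}) \<union> (if 1 \<in> V then topspace ?X - ?H else {})"
        using openin_subset[OF HS(1)] by auto
      moreover have "openin ?X \<dots>" using HS by (intro openin_Un) auto
      ultimately show "openin ?X {y \<in> topspace ?X. ?f y \<in> V}" by simp
    qed auto
  qed auto
  moreover have "?f ` C \<subseteq> {1}" using b(4) by auto
  ultimately show "\<exists>f :: 's \<Rightarrow> real. continuous_map ?X (top_of_set {0..1}) f \<and> f x = 0 \<and> f ` C \<subseteq> {1}"
    using xH by (intro exI[of _ ?f]) auto
qed

lemma openin_open_interval:
  "\<lbrakk>a \<in> S; b \<in> S\<rbrakk> \<Longrightarrow> openin (order_topology S r) (open_interval r a b)"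
  unfolding order_topology_def by (rule topology_generated_by_Basis) blast

lemma open_interval_nonempty:
  "\<lbrakk>(a, b) \<in> r; a \<noteq> b\<rbrakk> \<Longrightarrow> open_interval r a b \<noteq> {}"
  using dense r_carrier unfolding dense_order_def by blast

lemma topological_CCC_lower_limit_topology:
  assumes "topological_CCC (order_topology S r)"
  shows "topological_CCC (lower_limit_topology S r)"
  unfolding topological_CCC_def
proof (intro allI impI, elim conjE)
  fix \<U> assume U: "\<forall>U\<in>\<U>. openin (lower_limit_topology S r) U \<and> U \<noteq> {}" "pairwise disjnt \<U>"
  have "\<exists>J. J \<subseteq> U \<and> openin (order_topology S r) J \<and> J \<noteq> {}" if "U \<in> \<U>" for U
  proof -
    have "openin (lower_limit_topology S r) U" "U \<noteq> {}" using U(1) that by auto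
    then obtain x b where b: "x \<in> S" "b \<in> S" "(x, b) \<in> r" "x \<noteq> b" "half_open_interval r x b \<subseteq> U"
      unfolding openin_lower_limit_topology by fastforce
    have "open_interval r x b \<subseteq> half_open_interval r x b"
      unfolding open_interval_def half_open_interval_def by blast
    then show ?thesis
      using openin_open_interval[OF b(1,2)] open_interval_nonempty[OF b(3,4)] b(5) by blast
  qed
  then obtain J where J: "\<And>U. U \<in> \<U> \<Longrightarrow> J U \<subseteq> U"
    "\<And>U. U \<in> \<U> \<Longrightarrow> openin (order_topology S r) (J U)" "\<And>U. U \<in> \<U> \<Longrightarrow> J U \<noteq> {}"
    by metis
  have disj: "J U \<inter> J V = {}" if "U \<in> \<U>" "V \<in> \<U>" "U \<noteq> V" for U V
    using J(1)[OF that(1)] J(1)[OF that(2)] pairwiseD[OF U(2) that] unfolding disjnt_def by blast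
  show "countable \<U>"
    by (rule topological_CCC_countable_index[OF assms J(2,3) disj])
qed

lemma topspace_order_topology: "topspace (order_topology S r) = S"
proof -
  have "x \<in> \<Union>{open_interval r a b |a b. a \<in> S \<and> b \<in> S}" if "x \<in> S" for x
    using exists_less[OF that] exists_greater[OF that] unfolding open_interval_def by blast
  then show ?thesis
    unfolding order_topology_def topology_generated_by_topspace
    using r_carrier unfolding open_interval_def by blast
qed

lemma order_topology_interval_basis:
  assumes "openin (order_topology S r) U" "x \<in> U"
  shows "\<exists>a\<in>S. \<exists>b\<in>S. x \<in> open_interval r a b \<and> open_interval r a b \<subseteq> U"
proof -
  have "generate_topology_on {open_interval r a b |a b. a \<in> S \<and> b \<in> S} U"
    using assms(1) unfolding order_topology_def by (rule openin_topology_generated_by)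
  then show ?thesis
    using assms(2)
  proof (induction arbitrary: x rule: generate_topology_on.induct)
    case (Int U V)
    obtain a b where ab: "a \<in> S" "b \<in> S" "x \<in> open_interval r a b" "open_interval r a b \<subseteq> U"
      using Int by blast
    obtain a' b' where ab': "a' \<in> S" "b' \<in> S" "x \<in> open_interval r a' b'" "open_interval r a' b' \<subseteq> V"
      using Int by blast
    define l where "l = (if (a, a') \<in> r then a' else a)"
    define u where "u = (if (b, b') \<in> r then b else b')"
    have l: "l \<in> S" "(a, l) \<in> r" "(a', l) \<in> r" and u: "u \<in> S" "(u, b) \<in> r" "(u, b') \<in> r"
      using ab ab' r_total r_refl unfolding l_def u_def by auto
    have "x \<in> open_interval r l u"
      using ab(3) ab'(3) unfolding l_def u_def open_interval_def by auto
    moreover have "open_interval r l u \<subseteq> open_interval r a b" "open_interval r l u \<subseteq> open_interval r a' b'"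
      using l u r_trans r_antisym unfolding open_interval_def by blast+
    ultimately show ?case using l(1) u(1) ab(4) ab'(4) by blast
  next
    case (UN K)
    then show ?case by (meson Union_upper UnionE order_trans)
  qed blast+
qed

text \<open>
  A countable set is not dense, and a nonempty open set contains an interval.
\<close>

lemma countable_set_misses_interval:
  assumes "\<not> separable_space (order_topology S r)" "countable B" "B \<subseteq> S"
  shows "\<exists>a c. (a, c) \<in> r \<and> a \<noteq> c \<and> open_interval r a c \<inter> B = {}"
proof -
  have "order_topology S r closure_of B \<noteq> S"
    using assms unfolding separable_space_def topspace_order_topology by blast
  moreover have "order_topology S r closure_of B \<subseteq> S"
    using closure_of_subset_topspace[of "order_topology S r" B] by (simp add: topspace_order_topology)
  ultimately obtain x where "x \<in> S" "x \<notin> order_topology S r closure_of B" by blast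
  then obtain U where U: "openin (order_topology S r) U" "x \<in> U" "B \<inter> U = {}"
    unfolding in_closure_of topspace_order_topology by blast
  then obtain a c where "x \<in> open_interval r a c" "open_interval r a c \<subseteq> U"
    using order_topology_interval_basis by blast
  moreover from this have "(a, c) \<in> r" "a \<noteq> c"
    using r_trans r_antisym unfolding open_interval_def by blast+
  ultimately show ?thesis using U(3) by blast
qed

text \<open>
  Consider the boxes \<open>[a, b) \<times> [b, c)\<close> with \<open>a < b < c\<close>, and a maximal family of pairwise disjoint ones.
  If it were countable, its middle points would miss an open interval \<open>(a, c)\<close>. Any \<open>b\<close> in that interval
  gives a new box, disjoint from each box \<open>[a', b') \<times> [b', c')\<close> of the family: either \<open>b' \<le> a\<close>, and the
  first sides are disjoint, or \<open>c \<le> b'\<close>, and the second sides are. This contradicts maximality.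
  Maximality from Zorn's lemma replaces the usual transfinite recursion of length \<open>\<omega>\<^sub>1\<close>.
\<close>

lemma not_topological_CCC_square:
  assumes nonsep: "\<not> separable_space (order_topology S r)"
  shows "\<not> topological_CCC (prod_topology (lower_limit_topology S r) (lower_limit_topology S r))"
    (is "\<not> topological_CCC ?XX")
proof
  assume CCC: "topological_CCC ?XX"
  define R where "R = (\<lambda>(a, b, c). half_open_interval r a b \<times> half_open_interval r b c)"
  define P where "P = {(a, b, c). (a, b) \<in> r \<and> a \<noteq> b \<and> (b, c) \<in> r \<and> b \<noteq> c}"
  \<comment> \<open>The family is indexed by triples; since boxes are nonempty, disjointness makes the indexing injective.\<close>
  define \<F> where "\<F> = {F. F \<subseteq> P \<and> pairwise (\<lambda>p q. R p \<inter> R q = {}) F}"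
  have "\<Union>\<C> \<in> \<F>" if "subset.chain \<F> \<C>" for \<C>
  proof -
    have mem: "F \<subseteq> P" "pairwise (\<lambda>p q. R p \<inter> R q = {}) F" if "F \<in> \<C>" for F
      using \<open>subset.chain \<F> \<C>\<close> that unfolding subset_chain_def \<F>_def by auto
    have linked: "F \<subseteq> G \<or> G \<subseteq> F" if "F \<in> \<C>" "G \<in> \<C>" for F G
      using \<open>subset.chain \<F> \<C>\<close> that unfolding subset_chain_def by auto
    have "\<Union>\<C> \<subseteq> P" using mem(1) by (rule Union_least)
    moreover have "pairwise (\<lambda>p q. R p \<inter> R q = {}) (\<Union>\<C>)"
    proof (rule pairwiseI)
      fix p q assume "p \<in> \<Union>\<C>" "q \<in> \<Union>\<C>" and pq: "p \<noteq> q"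
      then obtain F G where FG: "F \<in> \<C>" "G \<in> \<C>" "p \<in> F" "q \<in> G" by auto
      then have "p \<in> G \<or> q \<in> F" using linked[OF FG(1,2)] by auto
      then show "R p \<inter> R q = {}"
        using FG pairwiseD[OF mem(2) _ _ pq] by auto
    qed
    ultimately show ?thesis by (simp add: \<F>_def)
  qed
  then obtain F where F: "F \<in> \<F>" and max: "\<And>G. \<lbrakk>G \<in> \<F>; F \<subseteq> G\<rbrakk> \<Longrightarrow> G = F"
    using subset_Zorn'[of \<F>] by auto
  have R_open: "openin ?XX (R p)" for p
    by (cases p) (simp add: R_def openin_prod_Times_iff openin_half_open_interval)
  have R_nonempty: "R p \<noteq> {}" if "p \<in> P" for p
  proof -
    obtain a b c where p: "p = (a, b, c)" by (cases p)
    have "(a, b) \<in> R p"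
      using that r_refl r_carrier unfolding p P_def R_def half_open_interval_def by auto
    then show ?thesis by blast
  qed
  have "countable F"
  proof (rule topological_CCC_countable_index[OF CCC, of F R])
    show "R p \<noteq> {}" if "p \<in> F" for p
      using F that by (intro R_nonempty) (auto simp: \<F>_def)
    show "R p \<inter> R q = {}" if "p \<in> F" "q \<in> F" "p \<noteq> q" for p q
      using F that by (simp add: \<F>_def pairwise_def)
  qed (rule R_open)
  define B where "B = (\<lambda>(a, b, c). b) ` F"
  have "countable B" unfolding B_def using \<open>countable F\<close> by (rule countable_image)
  have "B \<subseteq> S"
  proof
    fix b assume "b \<in> B"
    then obtain a c where "(a, b, c) \<in> F" unfolding B_def by force
    then have "(a, b) \<in> r" using F unfolding \<F>_def P_def by auto
    then show "b \<in> S" using r_carrier by simp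
  qed
  obtain a c where ac: "(a, c) \<in> r" "a \<noteq> c" and miss: "open_interval r a c \<inter> B = {}"
    using countable_set_misses_interval[OF nonsep \<open>countable B\<close> \<open>B \<subseteq> S\<close>] by (elim exE conjE) (rule that)
  obtain b where b: "b \<in> open_interval r a c" using open_interval_nonempty[OF ac] by auto
  then have b': "(a, b) \<in> r" "a \<noteq> b" "(b, c) \<in> r" "b \<noteq> c" unfolding open_interval_def by auto
  have "R (a, b, c) \<inter> R q = {}" if "q \<in> F" for q
  proof -
    obtain a1 b1 c1 where q: "q = (a1, b1, c1)" by (cases q)
    have "b1 \<in> B" using that q unfolding B_def by force
    then have "b1 \<notin> open_interval r a c" "b1 \<in> S" using miss \<open>B \<subseteq> S\<close> by blast+
    then have "(b1, a) \<in> r \<or> (c, b1) \<in> r"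
      using r_total[of a b1] r_total[of b1 c] r_refl[of b1] r_carrier[OF ac(1)]
      unfolding open_interval_def by auto
    then show ?thesis
    proof
      assume "(b1, a) \<in> r"
      then have "half_open_interval r a b \<inter> half_open_interval r a1 b1 = {}"
        unfolding half_open_interval_def by (auto dest: r_trans r_antisym)
      then show ?thesis unfolding q R_def by auto
    next
      assume "(c, b1) \<in> r"
      then have "half_open_interval r b c \<inter> half_open_interval r b1 c1 = {}"
        unfolding half_open_interval_def by (auto dest: r_trans r_antisym)
      then show ?thesis unfolding q R_def by auto
    qed
  qed
  then have "insert (a, b, c) F \<in> \<F>"
    using F b' unfolding \<F>_def P_def by (simp add: pairwise_insert Int_commute)
  then have "insert (a, b, c) F = F" by (rule max) auto
  then have "(a, b, c) \<in> F" by auto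
  then have "b \<in> B" unfolding B_def by force
  then show False using b miss by blast
qed

end

theorem corollary3p6:
  assumes "\<not> SH TYPE('s)"
  shows "\<exists>A :: ('s \<Rightarrow> complex) cstar_alg.
    cstar_algebra A \<and> cring A \<and> cstar_CCC A \<and>
    (\<exists>(C :: ('s \<times> 's \<Rightarrow> complex) cstar_alg) t.
      min_cstar_tensor_product A A C t \<and> \<not> cstar_CCC C)"
proof -
  obtain S :: "'s set" and r where "suslin_line S r"
    using assms unfolding SH_def by blast
  then have lin: "linear_order_on S r" and unb: "unbounded_order S r" and dense: "dense_order S r"
    and nonsep: "\<not> separable_space (order_topology S r)"
    and CCC: "topological_CCC (order_topology S r)"
    unfolding suslin_line_def by auto
  let ?X = "lower_limit_topology S r"
  note creg = completely_regular_lower_limit_topology[OF lin unb dense]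
  show ?thesis
  proof (intro exI[of _ "Cb_alg ?X"] conjI)
    show "cstar_algebra (Cb_alg ?X)" by (rule Cb.cstar_algebra_fun_alg)
    show "cring (Cb_alg ?X)"
      by (rule Cb.cring_fun_alg) (auto simp: indicator_topspace_mem_Cb, simp add: Cb_def)
    show "cstar_CCC (Cb_alg ?X)"
      by (intro cstar_CCC_Cb topological_CCC_lower_limit_topology lin unb dense CCC)
    show "\<exists>(C :: ('s \<times> 's \<Rightarrow> complex) cstar_alg) t.
        min_cstar_tensor_product (Cb_alg ?X) (Cb_alg ?X) C t \<and> \<not> cstar_CCC C"
      by (intro exI[of _ "Cb_tensor ?X ?X"] exI[of _ tensor_fun] conjI
          min_cstar_tensor_product_Cb[OF creg creg]
          not_cstar_CCC_Cb_tensor[OF creg creg not_topological_CCC_square[OF lin unb dense nonsep]])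
  qed
qed

end
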